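(* Let $V$ be a finite-dimensional Euclidean Jordan algebra (over $\mathbb{R}$, with identity $e$) of rank $d$, with cone of squares $\mathcal{Q}$. Let $$\Gamma(u,v,w) = -\log\bigl(u + v\log(\det(v^{-1}w))\bigr) - \log(v) - \log(\det(w)),$$ defined on the set of $(u,v,w) \in \mathbb{R}\times\mathbb{R}_{>}\times \operatorname{int}(\mathcal{Q})$ with $u + v\log(\det(v^{-1}w)) > 0$. Let $\tilde u = (u,v,w)$ be a point of this set and $\tilde p = (p,q,r) \in \mathbb{R}\times\mathbb{R}\times V$. Put $$\varphi = -\log(\det(v^{-1}w)), \quad \zeta = u - v\varphi, \quad \check r = P(w^{1/2}) r, \quad \theta = v^2\bigl(\zeta + (1+d)v\bigr)^{-1}.$$ Then the inverse Hessian product $(\bar H_u, \bar H_v, \bar H_w) = (\nabla^2\Gamma(\tilde u))^{-1}[\tilde p]$ is $$\bar H_v = \theta\bigl( (\zeta + v)(\varphi p + q) + d\zeta p + \operatorname{tr}(\check r) \bigr),$$ $$\bar H_u = \zeta(\zeta+v)^{-1}\bigl( d v^2 p + d \bar H_v - v\langle w, r\rangle \bigr) + \zeta^2 p + \varphi \bar H_v,$$ $$\bar H_w = (\zeta+v)^{-1} P(w^{1/2})\bigl( (-\zeta p v + \bar H_v) e + \zeta \check r \bigr).$$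
   Context: $\mathbb{R}_{>} = (0,\infty)$; $\operatorname{int}$ denotes interior. Jordan algebra conventions: the product is $\circ$; a Jordan algebra is Euclidean if $\langle w_a \circ w_b, w_c\rangle = \langle w_b, w_a \circ w_c\rangle$ for an inner product. The rank $d$ of $V$ is the number of elements in any Jordan frame (complete system of pairwise orthogonal primitive idempotents, summing to $e$). Every $w \in V$ has a spectral decomposition $w = \sum_{i=1}^d w_i c_i$ with real eigenvalues $w_i$ (not necessarily distinct) and a Jordan frame $c_1,\dots,c_d$. One sets $\operatorname{tr}(w) = \sum_i w_i$ and $\det(w) = \prod_i w_i$. The inner product on $V$ is $\langle w_a, w_b \rangle = \operatorname{tr}(w_a \circ w_b)$, and $\mathbb{R}\times\mathbb{R}\times V$ carries the product inner product. The cone of squares is $\mathcal{Q} = \{ w \circ w : w \in V\}$; $w \in \operatorname{int}(\mathcal{Q})$ iff all $w_i > 0$, and then $w^{1/2} = \sum_i w_i^{1/2} c_i$. $L(w) : V \to V$ is $L(w) x = w \circ x$, and the quadratic representation is $P(w) = 2 L(w)^2 - L(w \circ w)$. The Hessian $\nabla^2 \Gamma(\tilde u)$ is viewed as the self-adjoint linear operator on $\mathbb{R} \times\mathbb{R}\times V$ with $\langle \nabla^2\Gamma(\tilde u)[\tilde p], \tilde p'\rangle$ equal to the second directional derivative of $\Gamma$ at $\tilde u$ in directions $\tilde p, \tilde p'$; it is positive definite, and $(\nabla^2 \Gamma(\tilde u))^{-1}$ is its inverse operator. *)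

theory Defs
  imports "HOL-Analysis.Analysis"
begin

definition inner_product_form :: "('a::real_vector \<Rightarrow> 'a \<Rightarrow> real) \<Rightarrow> bool" where
  "inner_product_form B \<longleftrightarrow>
     bilinear B \<and> (\<forall>x y. B x y = B y x) \<and> (\<forall>x. x \<noteq> 0 \<longrightarrow> B x x > 0)"

text \<open>
  The vector space is the whole type. Its norm is unrelated to the Jordan product: it only
  supplies the topology, which does not depend on the norm because the dimension is finite.
\<close>

locale euclidean_jordan_algebra =
  fixes J :: "'a::real_normed_vector \<Rightarrow> 'a \<Rightarrow> 'a" and e :: 'a
  assumes finite_dimensional: "\<exists>S::'a set. finite S \<and> span S = UNIV"
    and bilinear: "bilinear J"
    and commute: "J a b = J b a"
    and jordan_identity: "J (J a b) (J a a) = J a (J b (J a a))"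
    and identity: "J e a = a"
    and euclidean: "\<exists>B. inner_product_form B \<and> (\<forall>a b c. B (J a b) c = B b (J a c))"

definition primitive_idempotent :: "('a::real_vector \<Rightarrow> 'a \<Rightarrow> 'a) \<Rightarrow> 'a \<Rightarrow> bool" where
  "primitive_idempotent J c \<longleftrightarrow> J c c = c \<and> c \<noteq> 0 \<and>
     \<not> (\<exists>a b. J a a = a \<and> J b b = b \<and> a \<noteq> 0 \<and> b \<noteq> 0 \<and> c = a + b)"

text \<open>
  Frames are sets rather than families; nothing is lost, since pairwise orthogonal nonzero
  idempotents are distinct.
\<close>

definition jordan_frame :: "('a::real_vector \<Rightarrow> 'a \<Rightarrow> 'a) \<Rightarrow> 'a \<Rightarrow> 'a set \<Rightarrow> bool" where
  "jordan_frame J e C \<longleftrightarrow> finite C \<and> (\<forall>c\<in>C. primitive_idempotent J c) \<and>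
     (\<forall>c\<in>C. \<forall>c'\<in>C. c \<noteq> c' \<longrightarrow> J c c' = 0) \<and> (\<Sum>c\<in>C. c) = e"

text \<open>
  In a Euclidean Jordan algebra frames and spectral decompositions exist, and the values
  below do not depend on their choice; so the definite descriptions denote.
\<close>

definition jordan_rank :: "('a::real_vector \<Rightarrow> 'a \<Rightarrow> 'a) \<Rightarrow> 'a \<Rightarrow> nat" where
  "jordan_rank J e = (THE n. \<exists>C. jordan_frame J e C \<and> card C = n)"

definition spectral_decomposition ::
  "('a::real_vector \<Rightarrow> 'a \<Rightarrow> 'a) \<Rightarrow> 'a \<Rightarrow> 'a \<Rightarrow> 'a set \<Rightarrow> ('a \<Rightarrow> real) \<Rightarrow> bool" where
  "spectral_decomposition J e w C l \<longleftrightarrow> jordan_frame J e C \<and> w = (\<Sum>c\<in>C. l c *\<^sub>R c)"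

definition jordan_tr :: "('a::real_vector \<Rightarrow> 'a \<Rightarrow> 'a) \<Rightarrow> 'a \<Rightarrow> 'a \<Rightarrow> real" where
  "jordan_tr J e w =
     (THE x. \<exists>C l. spectral_decomposition J e w C l \<and> x = (\<Sum>c\<in>C. l c))"

definition jordan_det :: "('a::real_vector \<Rightarrow> 'a \<Rightarrow> 'a) \<Rightarrow> 'a \<Rightarrow> 'a \<Rightarrow> real" where
  "jordan_det J e w =
     (THE x. \<exists>C l. spectral_decomposition J e w C l \<and> x = (\<Prod>c\<in>C. l c))"

text \<open>Only meaningful for elements all of whose eigenvalues are nonnegative.\<close>

definition jordan_sqrt :: "('a::real_vector \<Rightarrow> 'a \<Rightarrow> 'a) \<Rightarrow> 'a \<Rightarrow> 'a \<Rightarrow> 'a" where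
  "jordan_sqrt J e w =
     (THE x. \<exists>C l. spectral_decomposition J e w C l \<and> x = (\<Sum>c\<in>C. sqrt (l c) *\<^sub>R c))"

definition jordan_inner :: "('a::real_vector \<Rightarrow> 'a \<Rightarrow> 'a) \<Rightarrow> 'a \<Rightarrow> 'a \<Rightarrow> 'a \<Rightarrow> real" where
  "jordan_inner J e a b = jordan_tr J e (J a b)"

definition product_inner ::
  "('a::real_vector \<Rightarrow> 'a \<Rightarrow> 'a) \<Rightarrow> 'a \<Rightarrow> real \<times> real \<times> 'a \<Rightarrow> real \<times> real \<times> 'a \<Rightarrow> real" where
  "product_inner J e = (\<lambda>(p, q, r) (p', q', r'). p * p' + q * q' + jordan_inner J e r r')"

definition cone_of_squares :: "('a \<Rightarrow> 'a \<Rightarrow> 'a) \<Rightarrow> 'a set" where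
  "cone_of_squares J = {J w w | w. True}"

definition quad_rep :: "('a::real_vector \<Rightarrow> 'a \<Rightarrow> 'a) \<Rightarrow> 'a \<Rightarrow> 'a \<Rightarrow> 'a" where
  "quad_rep J w x = 2 *\<^sub>R J w (J w x) - J (J w w) x"

definition Gamma_dom ::
  "('a::real_normed_vector \<Rightarrow> 'a \<Rightarrow> 'a) \<Rightarrow> 'a \<Rightarrow> (real \<times> real \<times> 'a) set" where
  "Gamma_dom J e = {(u, v, w). v > 0 \<and> w \<in> interior (cone_of_squares J) \<and>
     u + v * ln (jordan_det J e (inverse v *\<^sub>R w)) > 0}"

text \<open>
  A total function; its values outside of \<open>Gamma_dom\<close> are irrelevant to the derivatives
  at points of that set, which is open.
\<close>

definition Gamma_barrier ::
  "('a::real_vector \<Rightarrow> 'a \<Rightarrow> 'a) \<Rightarrow> 'a \<Rightarrow> real \<times> real \<times> 'a \<Rightarrow> real" where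
  "Gamma_barrier J e = (\<lambda>(u, v, w).
     - ln (u + v * ln (jordan_det J e (inverse v *\<^sub>R w))) - ln v - ln (jordan_det J e w))"

definition second_directional_deriv ::
  "('b::real_vector \<Rightarrow> real) \<Rightarrow> 'b \<Rightarrow> 'b \<Rightarrow> 'b \<Rightarrow> real" where
  "second_directional_deriv f x a b =
     deriv (\<lambda>s. deriv (\<lambda>t. f (x + s *\<^sub>R b + t *\<^sub>R a)) 0) 0"

definition hessian_operator ::
  "('b::real_vector \<Rightarrow> 'b \<Rightarrow> real) \<Rightarrow> ('b \<Rightarrow> real) \<Rightarrow> 'b \<Rightarrow> 'b \<Rightarrow> 'b" where
  "hessian_operator ip f x =
     (THE A. linear A \<and> (\<forall>a b. ip (A a) b = second_directional_deriv f x a b))"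

end

theory Submission
  imports Defs "HOL-Computational_Algebra.Fundamental_Theorem_Algebra"
begin

text \<open>
  Write \<open>L = ln \<circ> det\<close>, let \<open>d\<close> be the rank and \<open>\<zeta> = u + v (L w - d ln v)\<close>. On positive elements \<open>L\<close> has
  the gradient \<open>w\<^sup>-\<^sup>1\<close> (\<open>lndet_derivative\<close>), and \<open>w\<^sup>-\<^sup>1\<close> has the derivative \<open>- P (w\<^sup>-\<^sup>1)\<close>
  (\<open>inverse_derivative\<close>). This gives the Hessian explicitly (\<open>hessian_operator_Gamma\<close>). The only operator
  in it is \<open>P (w\<^sup>-\<^sup>1)\<close>, and \<open>P (w\<^sup>1\<^sup>/\<^sup>2)\<close> turns it into the identity and \<open>w\<^sup>-\<^sup>1\<close> into \<open>e\<close>, so the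
  system for the inverse reduces by block elimination to one scalar equation for \<open>Hv\<close>
  (\<open>Gamma_hessian_solution\<close>). A symmetric operator with full range is injective, so the solutions found
  also show that the Hessian is bijective.

  Most of the text derives the required facts on Euclidean Jordan algebras from the axioms.
  The linearised Jordan identity gives power associativity, so each element generates an associative
  algebra on which it acts symmetrically for the given inner product. Its minimal polynomial therefore
  splits with simple real roots, and refining the eigenprojections as far as possible gives spectral
  decompositions into primitive idempotents (\<open>spectral_decomposition_exists\<close>).

  That rank, trace, determinant and square root do not depend on the decomposition rests on one
  observation: two primitive idempotents that are not orthogonal have the same norm in any associative
  inner product (\<open>nonorthogonal_primitives_same_norm\<close>). Weighting the members of one frame by their
  inverse squared norms then gives a central element representing the trace, which makes the trace
  linear and the trace form associative. For two frames the trace forms of the pairs constitute a doubly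
  stochastic matrix, which vanishes at pairs with different eigenvalues if both frames diagonalise the
  same element; this makes functional calculus well defined (\<open>functional_calculus_unique\<close>), and it also
  carries the concavity of \<open>L\<close> over from the logarithm (\<open>lndet_concave\<close>).

  Differentiability is then obtained along lines: the inverse from the identity
  \<open>P x x\<^sup>-\<^sup>1 = x\<close>, and \<open>L\<close> from enclosing its difference quotients by concavity.
\<close>

section \<open>Real polynomials and finite sums\<close>

lemma poly_of_real_hom:
  "poly (map_poly complex_of_real (p + q)) z =
     poly (map_poly of_real p) z + poly (map_poly of_real q) z"
  "poly (map_poly complex_of_real (p * q)) z =
     poly (map_poly of_real p) z * poly (map_poly of_real q) z"
proof -
  have s: "poly (map_poly complex_of_real (smult a p)) z = of_real a * poly (map_poly of_real p) z" for a p
    by (induction p) (auto simp: map_poly_pCons algebra_simps)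
  have a: "poly (map_poly complex_of_real (p + q)) z =
     poly (map_poly of_real p) z + poly (map_poly of_real q) z" for p q
    by (induction p q rule: poly_induct2) (auto simp: map_poly_pCons algebra_simps)
  show "poly (map_poly complex_of_real (p + q)) z =
     poly (map_poly of_real p) z + poly (map_poly of_real q) z" by (rule a)
  show "poly (map_poly complex_of_real (p * q)) z =
     poly (map_poly of_real p) z * poly (map_poly of_real q) z"
    by (induction p) (auto simp: map_poly_pCons a s algebra_simps)
qed

text \<open>
  A complex root \<open>z\<close> that is not real contributes the factor \<open>(X - z) (X - cnj z)\<close>; the
  remainder of the division by this real quadratic has degree at most one and vanishes at \<open>z\<close>.
\<close>

lemma real_poly_root_or_quadratic_factor:
  fixes g :: "real poly"
  assumes "degree g > 0"
  shows "(\<exists>a. poly g a = 0) \<or> (\<exists>a b. [:a\<^sup>2 + b\<^sup>2, - 2 * a, 1:] dvd g)"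
proof -
  let ?c = "map_poly complex_of_real"
  have "degree (?c g) = degree g" by (rule degree_map_poly) auto
  then obtain z where z: "poly (?c g) z = 0"
    using assms fundamental_theorem_of_algebra[of "?c g"] constant_degree[of "?c g"] by auto
  define q where "q = [:(Re z)\<^sup>2 + (Im z)\<^sup>2, - 2 * Re z, 1:]"
  define r where "r = g mod q"
  have "degree r < 2"
    using degree_mod_less[of q g] by (cases "r = 0") (auto simp: q_def r_def)
  then obtain r0 r1 where r: "r = [:r0, r1:]"
    by (metis (no_types) degree_eq_zeroE less_2_cases One_nat_def pCons_0_0 degree1_coeffs)
  have qz: "poly (?c q) z = 0"
    by (simp add: q_def map_poly_pCons complex_eq_iff power2_eq_square algebra_simps)
  have "g = q * (g div q) + r" by (simp add: r_def)
  then have "poly (?c g) z = poly (?c q) z * poly (?c (g div q)) z + poly (?c r) z"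
    using poly_of_real_hom(1)[of "q * (g div q)" r z] poly_of_real_hom(2)[of q "g div q" z] by simp
  then have rz: "poly (?c r) z = 0" using z qz by simp
  show ?thesis
  proof (cases "Im z = 0")
    case True
    then have "z = of_real (Re z)" by (simp add: complex_eq_iff)
    moreover have "poly (?c g) (of_real t) = of_real (poly g t)" for t
      by (induction g) (auto simp: map_poly_pCons)
    ultimately have "complex_of_real (poly g (Re z)) = 0" using z by metis
    then have "poly g (Re z) = 0" by simp
    then show ?thesis by blast
  next
    case False
    with rz have "r = 0" by (auto simp: r map_poly_pCons complex_eq_iff)
    then have "q dvd g" by (simp add: r_def mod_eq_0_iff_dvd)
    then show ?thesis unfolding q_def by blast
  qed
qed

text \<open>
  Both sides take the value 1 at the interpolation nodes and have degree below their number.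
\<close>

lemma lagrange_sum_1:
  assumes "finite \<Lambda>" "\<Lambda> \<noteq> {}"
  defines "lag \<equiv> \<lambda>a. smult (inverse (\<Prod>b\<in>\<Lambda> - {a}. a - b)) (\<Prod>b\<in>\<Lambda> - {a}. [:- b, 1::real:])"
  shows "(\<Sum>a\<in>\<Lambda>. lag a) = 1"
proof (rule poly_eqI_degree)
  fix t assume t: "t \<in> \<Lambda>"
  have "poly (lag a) t = (if a = t then 1 else 0)" if "a \<in> \<Lambda>" for a
    using t that assms(1) unfolding lag_def
    by (auto simp: poly_prod algebra_simps)
  then show "poly (\<Sum>a\<in>\<Lambda>. lag a) t = poly 1 t"
    using t assms(1) by (simp add: poly_sum)
next
  have pos: "card \<Lambda> > 0" using assms by (simp add: card_gt_0_iff)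
  have "degree (lag a) < card \<Lambda>" if "a \<in> \<Lambda>" for a
  proof -
    have "degree (lag a) \<le> (\<Sum>b\<in>\<Lambda> - {a}. 1)"
      unfolding lag_def
      by (rule order.trans[OF degree_smult_le], rule order.trans[OF degree_prod_sum_le])
         (use assms in auto)
    also have "\<dots> < card \<Lambda>" using that assms pos by simp
    finally show ?thesis .
  qed
  then show "degree (\<Sum>a\<in>\<Lambda>. lag a) < card \<Lambda>"
    using pos by (intro degree_sum_less) auto
  show "degree (1::real poly) < card \<Lambda>" using pos by simp
qed

text \<open>
  The weights are the eigenvalues of the idempotents of a frame at a joint eigenvector. Since they
  sum to one, a joint eigenvector lives either in a diagonal Peirce space (one weight 1) or in an
  off-diagonal one (two weights 1/2). The expression is the eigenvalue of the quadratic
  representation of \<open>\<Sum> l c c\<close>, and the point is that it is multiplicative in \<open>l\<close>.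
\<close>

lemma half_weights:
  fixes k :: "'b \<Rightarrow> real"
  assumes "finite C" "\<And>c. c \<in> C \<Longrightarrow> k c \<in> {0, 1/2, 1}" "(\<Sum>c\<in>C. k c) = 1"
  shows "\<exists>i\<in>C. \<exists>j\<in>C. \<forall>l. 2 * (\<Sum>c\<in>C. l c * k c)\<^sup>2 - (\<Sum>c\<in>C. (l c)\<^sup>2 * k c) = l i * l j"
proof -
  have nonneg: "k c \<ge> 0" if "c \<in> C" for c using assms(2)[OF that] by auto
  have zero: "k c = 0" if "A \<subseteq> C" "(\<Sum>c\<in>A. k c) \<le> 0" "c \<in> A" for c A
  proof -
    have "finite A" using that assms(1) finite_subset by blast
    moreover have "(\<Sum>c\<in>A. k c) = 0" using that nonneg sum_nonneg[of A k] by fastforce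
    ultimately show ?thesis using that nonneg sum_nonneg_eq_0_iff[of A k] by blast
  qed
  obtain i where i: "i \<in> C" "k i \<noteq> 0"
    using assms(3) by (metis sum.neutral zero_neq_one)
  have rem: "k i + (\<Sum>c\<in>C - {i}. k c) = 1"
    using assms(1,3) i sum.remove by metis
  show ?thesis
  proof (cases "k i = 1")
    case True
    then have z: "k c = 0" if "c \<in> C - {i}" for c using zero[of "C - {i}" c] rem that by auto
    have "(\<Sum>c\<in>C. f c * k c) = f i" for f
      using sum.remove[OF assms(1) i(1), of "\<lambda>c. f c * k c"] z True by simp
    then show ?thesis using i(1) by (intro bexI[of _ i]) (auto simp: power2_eq_square)
  next
    case False
    then have ki: "k i = 1/2" using assms(2)[OF i(1)] i(2) by auto
    then have "(\<Sum>c\<in>C - {i}. k c) \<noteq> 0" using rem by auto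
    then obtain j where j: "j \<in> C - {i}" "k j \<noteq> 0" by (metis sum.neutral)
    have rem2: "k j + (\<Sum>c\<in>C - {i} - {j}. k c) = 1/2"
      using sum.remove[of "C - {i}" j k] assms(1) j rem ki by auto
    have kj: "k j \<ge> 1/2" using assms(2)[of j] j by auto
    then have z: "k c = 0" if "c \<in> C - {i} - {j}" for c
      using zero[of "C - {i} - {j}" c] rem2 that by auto
    then have kj: "k j = 1/2" using rem2 by simp
    have S: "(\<Sum>c\<in>C. f c * k c) = f i / 2 + f j / 2" for f
      using sum.remove[OF assms(1) i(1), of "\<lambda>c. f c * k c"] z ki kj
        sum.remove[of "C - {i}" j "\<lambda>c. f c * k c"] assms(1) j by simp
    then show ?thesis using i(1) j
      by (intro bexI[of _ i] bexI[of _ j] allI, unfold S) (auto simp: power2_eq_square field_simps)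
  qed
qed

section \<open>Linearised Jordan identity and power associativity\<close>

context euclidean_jordan_algebra
begin

notation J (infixl "\<odot>" 70)

lemmas J_distribs =
  bilinear_ladd[OF bilinear] bilinear_radd[OF bilinear] bilinear_lsub[OF bilinear]
  bilinear_rsub[OF bilinear] bilinear_lmul[OF bilinear] bilinear_rmul[OF bilinear]
  bilinear_lneg[OF bilinear] bilinear_rneg[OF bilinear]

lemma J_zero [simp]: "0 \<odot> a = 0" "a \<odot> 0 = 0"
  using bilinear_lzero[OF bilinear] bilinear_rzero[OF bilinear] by auto

lemma J_sum_left: "(\<Sum>i\<in>A. f i) \<odot> a = (\<Sum>i\<in>A. f i \<odot> a)"
  by (induction A rule: infinite_finite_induct) (auto simp: J_distribs)

lemma J_sum_right: "a \<odot> (\<Sum>i\<in>A. f i) = (\<Sum>i\<in>A. a \<odot> f i)"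
  by (induction A rule: infinite_finite_induct) (auto simp: J_distribs)

lemma J_e_right [simp]: "a \<odot> e = a" and J_e_left [simp]: "e \<odot> a = a"
  using identity commute by metis+

lemma scaleR_4: "(4::real) *\<^sub>R x = x + x + (x + (x::'a))"
  using scaleR_add_left[of 2 2 x] by (simp add: scaleR_2)

text \<open>
  The part of degree one in \<open>d\<close> of the Jordan identity at \<open>a + d\<close>. Subtracting the identity at
  \<open>a - d\<close> isolates the odd part, and the cubic term is the identity at \<open>d\<close>.
\<close>

lemma jordan_linearised:
  "d \<odot> ((a \<odot> a) \<odot> b) - (a \<odot> a) \<odot> (d \<odot> b)
    + 2 *\<^sub>R (a \<odot> ((a \<odot> d) \<odot> b) - (a \<odot> d) \<odot> (a \<odot> b)) = 0" (is "?t = 0")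
proof -
  define D where "D = (\<lambda>a. a \<odot> ((a \<odot> a) \<odot> b) - (a \<odot> a) \<odot> (a \<odot> b))"
  have D0: "D y = 0" for y
    using jordan_identity[of y b] unfolding D_def by (metis commute eq_iff_diff_eq_0)
  have "2 *\<^sub>R ?t = D (a + d) - D (a - d) - 2 *\<^sub>R D d"
    unfolding D_def by (simp add: J_distribs commute[of d a] algebra_simps scaleR_2 scaleR_4)
  then show ?thesis by (simp add: D0)
qed

lemma jordan_polarised:
  "d \<odot> ((a \<odot> g) \<odot> b) - (a \<odot> g) \<odot> (d \<odot> b)
    + (a \<odot> ((g \<odot> d) \<odot> b) - (g \<odot> d) \<odot> (a \<odot> b))
    + (g \<odot> ((a \<odot> d) \<odot> b) - (a \<odot> d) \<odot> (g \<odot> b)) = 0" (is "?t = 0")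
proof -
  define D where "D = (\<lambda>a. d \<odot> ((a \<odot> a) \<odot> b) - (a \<odot> a) \<odot> (d \<odot> b)
    + 2 *\<^sub>R (a \<odot> ((a \<odot> d) \<odot> b) - (a \<odot> d) \<odot> (a \<odot> b)))"
  have "2 *\<^sub>R ?t = D (a + g) - D a - D g"
    unfolding D_def by (simp add: J_distribs commute[of g a] algebra_simps scaleR_2)
  then show ?thesis by (simp add: D_def jordan_linearised)
qed

text \<open>
  The polarised identity, read as an identity of operators applied to \<open>d\<close>: multiplication by
  \<open>a x x\<close> is a noncommutative polynomial in the multiplications by \<open>x\<close>, \<open>x x\<close>, \<open>a\<close> and \<open>a x\<close>.
  With \<open>a\<close> a power of \<open>x\<close> it is a recursion for the multiplications by powers.
\<close>

lemma triple_product_operator: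
  "((a \<odot> x) \<odot> x) \<odot> d = 2 *\<^sub>R ((a \<odot> x) \<odot> (x \<odot> d)) + (x \<odot> x) \<odot> (a \<odot> d)
     - a \<odot> (x \<odot> (x \<odot> d)) - x \<odot> (x \<odot> (a \<odot> d))"
  using jordan_polarised[of d a x x]
  by (simp add: commute scaleR_2 algebra_simps)

primrec jpow :: "'a \<Rightarrow> nat \<Rightarrow> 'a" where
  "jpow x 0 = e" | "jpow x (Suc n) = x \<odot> jpow x n"

text \<open>
  By the recursion above, multiplication by a power of \<open>x\<close> is a polynomial in the multiplications
  by \<open>x\<close> and by \<open>x x\<close>.
\<close>

lemma power_operator_commutes:
  assumes "linear T" "\<And>y. T (x \<odot> y) = x \<odot> T y"
    and "\<And>y. T ((x \<odot> x) \<odot> y) = (x \<odot> x) \<odot> T y"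
  shows "T (jpow x n \<odot> y) = jpow x n \<odot> T y"
proof (induction n arbitrary: y rule: less_induct)
  case (less n)
  consider "n = 0" | "n = 1" | m where "n = Suc (Suc m)" by (metis One_nat_def not0_implies_Suc)
  then show ?case
  proof cases
    case 3
    have p: "jpow x n = (jpow x m \<odot> x) \<odot> x" by (simp add: 3 commute)
    have q: "jpow x m \<odot> x = jpow x (Suc m)" by (simp add: commute)
    show ?thesis
      unfolding p unfolding triple_product_operator unfolding q
      using less[of m] less[of "Suc m"] 3 assms
      by (simp add: linear_add linear_diff linear_cmul del: jpow.simps)
  qed (auto simp: assms)
qed

text \<open>
  Power associativity: multiplication by \<open>x\<close> commutes with multiplication by \<open>x x\<close>, which is the
  Jordan identity, hence with multiplication by any power of \<open>x\<close>.
\<close>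

lemma jpow_add: "jpow x m \<odot> jpow x n = jpow x (m + n)"
proof (induction m)
  case (Suc m)
  have lin: "linear (\<lambda>y. x \<odot> y)" using bilinear by (simp add: bilinear_def)
  have "x \<odot> (jpow x n \<odot> jpow x m) = jpow x n \<odot> (x \<odot> jpow x m)"
    by (rule power_operator_commutes[OF lin]) (metis jordan_identity commute)+
  with Suc show ?case by (simp add: commute)
qed simp

section \<open>An associative inner product and positivity of idempotents\<close>

definition form :: "'a \<Rightarrow> 'a \<Rightarrow> real" where
  "form = (SOME B. inner_product_form B \<and> (\<forall>a b c. B (a \<odot> b) c = B b (a \<odot> c)))"

lemma form: "inner_product_form form" and form_assoc: "form (a \<odot> b) c = form b (a \<odot> c)"
  using someI_ex[OF euclidean] unfolding form_def by auto

lemma form_bilinear: "bilinear form" and form_sym: "form x y = form y x"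
  and form_pos: "x \<noteq> 0 \<Longrightarrow> form x x > 0"
  using form by (auto simp: inner_product_form_def)

lemmas form_distribs =
  bilinear_ladd[OF form_bilinear] bilinear_radd[OF form_bilinear] bilinear_lsub[OF form_bilinear]
  bilinear_rsub[OF form_bilinear] bilinear_lmul[OF form_bilinear] bilinear_rmul[OF form_bilinear]
  bilinear_lneg[OF form_bilinear] bilinear_rneg[OF form_bilinear]

lemma form_zero [simp]: "form 0 a = 0" "form a 0 = 0"
  using bilinear_lzero[OF form_bilinear] bilinear_rzero[OF form_bilinear] by auto

lemma form_sum_left: "form (\<Sum>i\<in>A. f i) a = (\<Sum>i\<in>A. form (f i) a)"
  by (induction A rule: infinite_finite_induct) (auto simp: form_distribs)

lemma form_sum_right: "form a (\<Sum>i\<in>A. f i) = (\<Sum>i\<in>A. form a (f i))"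
  by (induction A rule: infinite_finite_induct) (auto simp: form_distribs)

lemma form_self_nonneg: "form x x \<ge> 0"
  using form_pos[of x] by (cases "x = 0") auto

lemma form_self_eq_0 [simp]: "form x x = 0 \<longleftrightarrow> x = 0"
  using form_pos[of x] by fastforce

text \<open>
  The possible eigenvalues of multiplication by an idempotent are 0, 1/2 and 1.
\<close>

lemma idempotent_cubic:
  assumes "c \<odot> c = c"
  shows "2 *\<^sub>R (c \<odot> (c \<odot> (c \<odot> x))) = 3 *\<^sub>R (c \<odot> (c \<odot> x)) - c \<odot> x"
proof -
  define y where "y = c \<odot> x"
  have "y - c \<odot> y + 2 *\<^sub>R (c \<odot> (c \<odot> y) - c \<odot> y) = 0"
    using jordan_linearised[of x c c] assms by (simp add: y_def commute[of x c] commute[of "c \<odot> x" c])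
  moreover have "3 *\<^sub>R (c \<odot> y) = c \<odot> y + 2 *\<^sub>R (c \<odot> y)"
    using scaleR_add_left[of 1 2 "c \<odot> y"] by simp
  ultimately show ?thesis
    by (simp add: y_def algebra_simps)
qed

text \<open>
  With \<open>L\<close> the multiplication by \<open>c\<close>, this is \<open>L = L\<^sup>2 + 4 (L - L\<^sup>2)\<^sup>2\<close>, which holds at the
  eigenvalues 0, 1/2 and 1. It writes \<open>L\<close> as a sum of squares of symmetric operators, so \<open>L\<close> is
  positive semidefinite, and vectors at which its quadratic form vanishes are in its kernel.
\<close>

lemma idempotent_form:
  fixes c x :: 'a
  assumes "c \<odot> c = c"
  defines "z \<equiv> c \<odot> x - c \<odot> (c \<odot> x)"
  shows "form (c \<odot> x) x = form (c \<odot> x) (c \<odot> x) + 4 * form z z"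
proof -
  define y y2 y3 where "y = c \<odot> x" and "y2 = c \<odot> y" and "y3 = c \<odot> y2"
  have y3: "2 *\<^sub>R y3 = 3 *\<^sub>R y2 - y"
    using idempotent_cubic[OF assms(1), of x] by (simp add: y_def y2_def y3_def)
  have *: "2 * form w y3 = 3 * form w y2 - form w y" for w
  proof -
    have "form w (2 *\<^sub>R y3) = form w (3 *\<^sub>R y2 - y)" by (simp only: y3)
    then show ?thesis by (simp add: form_distribs)
  qed
  have "form y y2 = form x y3" "form y2 y2 = form y y3" "form y y = form x y2"
    by (simp_all add: y_def y2_def y3_def form_assoc)
  then show ?thesis
    using *[of x] *[of y] unfolding z_def y_def[symmetric] y2_def[symmetric]
    by (simp add: form_distribs form_sym[of y x] form_sym[of y2 y])
qed

lemma idempotent_nonneg: "c \<odot> c = c \<Longrightarrow> form (c \<odot> x) x \<ge> 0"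
  using idempotent_form[of c x] form_self_nonneg[of "c \<odot> x"]
    form_self_nonneg[of "c \<odot> x - c \<odot> (c \<odot> x)"] by linarith

lemma idempotent_kernel: "c \<odot> c = c \<Longrightarrow> form (c \<odot> x) x = 0 \<Longrightarrow> c \<odot> x = 0"
  using idempotent_form[of c x] form_self_nonneg[of "c \<odot> x"]
    form_self_nonneg[of "c \<odot> x - c \<odot> (c \<odot> x)"] form_pos[of "c \<odot> x"] by fastforce

lemma idempotents_form_nonneg: "c \<odot> c = c \<Longrightarrow> d \<odot> d = d \<Longrightarrow> form c d \<ge> 0"
  using idempotent_nonneg[of c d] form_assoc[of d c d] commute[of c d] by simp

lemma idempotents_orthogonal_iff:
  assumes "c \<odot> c = c" "d \<odot> d = d"
  shows "form c d = 0 \<longleftrightarrow> c \<odot> d = 0"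
  using idempotent_kernel[of c d] form_assoc[of d c d] commute[of c d] assms by auto

section \<open>Spectral decompositions\<close>

definition peval :: "'a \<Rightarrow> real poly \<Rightarrow> 'a" where
  "peval x p = (\<Sum>i\<le>degree p. coeff p i *\<^sub>R jpow x i)"

lemma peval_eq: "degree p \<le> n \<Longrightarrow> peval x p = (\<Sum>i\<le>n. coeff p i *\<^sub>R jpow x i)"
  unfolding peval_def by (intro sum.mono_neutral_left) (auto simp: coeff_eq_0)

lemma peval_add: "peval x (p + q) = peval x p + peval x q"
  using degree_add_le_max[of p q]
  by (simp add: peval_eq[of _ "max (degree p) (degree q)"] scaleR_left_distrib sum.distrib)

lemma peval_smult: "peval x (smult a p) = a *\<^sub>R peval x p"
  by (simp add: peval_eq[of _ "degree p"] scaleR_sum_right degree_smult_le)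

lemma peval_pCons: "peval x (pCons a p) = a *\<^sub>R e + x \<odot> peval x p"
proof -
  have "degree (pCons a p) \<le> Suc (degree p)" by (simp add: degree_pCons_eq_if)
  then show ?thesis
    by (simp add: peval_eq[of _ "Suc (degree p)"] peval_def[of x p] sum.atMost_Suc_shift J_sum_right J_distribs
        del: sum.atMost_Suc)
qed

lemma peval_0 [simp]: "peval x 0 = 0"
  by (simp add: peval_def)

lemma peval_1 [simp]: "peval x 1 = e"
  by (simp add: peval_def)

lemma peval_diff: "peval x (p - q) = peval x p - peval x q"
  using peval_add[of x "p - q" q] by simp

lemma peval_sum: "peval x (\<Sum>i\<in>A. f i) = (\<Sum>i\<in>A. peval x (f i))"
  by (induction A rule: infinite_finite_induct) (auto simp: peval_add)

text \<open>
  By power associativity evaluation at \<open>x\<close> is a ring homomorphism onto an associative subalgebra.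
\<close>

lemma peval_mult: "peval x (p * q) = peval x p \<odot> peval x q"
proof (induction p)
  case (pCons a p)
  have "x \<odot> (peval x p \<odot> peval x q) = (x \<odot> peval x p) \<odot> peval x q"
    unfolding peval_def
    by (simp add: J_sum_left J_sum_right J_distribs jpow_add flip: jpow.simps(2))
  with pCons show ?case
    by (simp add: peval_add peval_smult peval_pCons J_distribs)
qed simp

lemma form_peval: "form (peval x (p * q)) (peval x r) = form (peval x p) (peval x (q * r))"
  by (simp add: peval_mult form_assoc mult.commute[of p q])

lemma independent_card_bound: "\<exists>N. \<forall>F::'a set. independent F \<longrightarrow> finite F \<and> card F \<le> N"
proof -
  obtain S :: "'a set" where "finite S" "span S = UNIV" using finite_dimensional by blast
  then show ?thesis using independent_span_bound[of S] by (intro exI[of _ "card S"]) auto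
qed

text \<open>
  The powers of \<open>x\<close> cannot all be independent in finite dimension.
\<close>

lemma annihilating_poly_exists: "\<exists>p. p \<noteq> 0 \<and> peval x p = 0"
proof -
  obtain N where N: "\<And>F::'a set. independent F \<Longrightarrow> finite F \<and> card F \<le> N"
    using independent_card_bound by blast
  show ?thesis
  proof (cases "inj_on (jpow x) {..N}")
    case False
    then obtain i j where "i \<noteq> j" "jpow x i = jpow x j" by (auto simp: inj_on_def)
    moreover have "peval x (monom 1 k) = jpow x k" for k
      by (simp add: peval_def degree_monom_eq if_distrib[of "\<lambda>c. c *\<^sub>R _"] sum.If_cases cong: if_cong)
    ultimately have "peval x (monom 1 i - monom 1 j) = 0" "monom (1::real) i - monom 1 j \<noteq> 0"
      by (auto simp: peval_diff monom_eq_iff')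
    then show ?thesis by blast
  next
    case inj: True
    have "dependent (jpow x ` {..N})"
      using N[of "jpow x ` {..N}"] card_image[OF inj] by auto
    then obtain u where u: "\<exists>v\<in>jpow x ` {..N}. u v \<noteq> 0" "(\<Sum>v\<in>jpow x ` {..N}. u v *\<^sub>R v) = 0"
      using dependent_finite[of "jpow x ` {..N}"] by auto
    define p where "p = (\<Sum>i\<le>N. monom (u (jpow x i)) i)"
    have c: "coeff p i = (if i \<le> N then u (jpow x i) else 0)" for i
      by (simp add: p_def coeff_sum)
    have "peval x p = (\<Sum>i\<le>N. coeff p i *\<^sub>R jpow x i)"
      by (rule peval_eq, rule degree_le) (simp add: c)
    also have "\<dots> = 0"
      using u(2) by (simp add: c sum.reindex[OF inj])
    finally have "peval x p = 0" .
    moreover have "p \<noteq> 0"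
    proof
      assume "p = 0"
      obtain i where "i \<le> N" "u (jpow x i) \<noteq> 0" using u(1) by auto
      then show False using c[of i] \<open>p = 0\<close> by simp
    qed
    ultimately show ?thesis by blast
  qed
qed

text \<open>
  If \<open>p = ((X - a)\<^sup>2 + b\<^sup>2) g\<close> annihilates \<open>x\<close>, then
  \<open>|(x - a) g(x)|\<^sup>2 + b\<^sup>2 |g(x)|\<^sup>2 = 0\<close> because multiplication by \<open>x\<close> is symmetric, so already
  \<open>(X - a) g\<close> annihilates \<open>x\<close>. The case \<open>b = 0\<close> excludes double roots, the other case excludes
  nonreal ones.
\<close>

lemma minimal_annihilator_no_quadratic_factor:
  assumes min: "\<And>q. q \<noteq> 0 \<Longrightarrow> peval x q = 0 \<Longrightarrow> degree p \<le> degree q"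
    and p: "p \<noteq> 0" "peval x p = 0"
  shows "\<not> [:a\<^sup>2 + b\<^sup>2, - 2 * a, 1:] dvd p"
proof
  assume "[:a\<^sup>2 + b\<^sup>2, - 2 * a, 1:] dvd p"
  then obtain g where g: "p = [:a\<^sup>2 + b\<^sup>2, - 2 * a, 1:] * g" by (auto elim: dvdE)
  define h where "h = [:- a, 1:] * g"
  have "g \<noteq> 0" using p g by auto
  then have "h \<noteq> 0" unfolding h_def by (simp only: mult_eq_0_iff) simp
  moreover have "degree h = 1 + degree g"
    unfolding h_def using \<open>g \<noteq> 0\<close> by (subst degree_mult_eq) auto
  moreover have "degree p = 2 + degree g"
    unfolding g using \<open>g \<noteq> 0\<close> by (subst degree_mult_eq) auto
  ultimately have "degree h < degree p" "h \<noteq> 0" by auto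
  have form_e: "form (peval x r) (peval x s) = form (peval x (r * s)) e" for r s
    using form_peval[of x r s 1] by simp
  have "h * h + smult (b\<^sup>2) (g * g) = p * g"
    unfolding g h_def
    by (intro poly_eq_poly_eq_iff[THEN iffD1] ext) (simp add: algebra_simps power2_eq_square)
  then have "form (peval x h) (peval x h) + b\<^sup>2 * form (peval x g) (peval x g) = form (peval x p) (peval x g)"
    unfolding form_e by (simp add: form_distribs peval_add peval_smult flip: \<open>_ = p * g\<close>)
  then have "form (peval x h) (peval x h) = 0"
    using p(2) form_self_nonneg[of "peval x h"] form_self_nonneg[of "peval x g"]
    by (simp add: add_nonneg_eq_0_iff)
  then show False
    using min[OF \<open>h \<noteq> 0\<close>] \<open>degree h < degree p\<close> by simp
qed

lemma minimal_annihilator_splits: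
  assumes min: "\<And>q. q \<noteq> 0 \<Longrightarrow> peval x q = 0 \<Longrightarrow> degree p \<le> degree q"
    and p: "p \<noteq> 0" "peval x p = 0"
    and "g dvd p"
  shows "\<exists>\<Lambda> c. finite \<Lambda> \<and> g = smult c (\<Prod>a\<in>\<Lambda>. [:- a, 1:])"
  using \<open>g dvd p\<close>
proof (induction "degree g" arbitrary: g)
  case 0
  then obtain c where "g = [:c:]" using degree_eq_zeroE by metis
  then show ?case by (intro exI[of _ "{}"] exI[of _ c]) simp
next
  case (Suc n)
  have noquad: "\<not> [:a\<^sup>2 + b\<^sup>2, - 2 * a, 1:] dvd g" for a b
    using minimal_annihilator_no_quadratic_factor[OF min p] Suc.prems dvd_trans by blast
  then obtain a where "poly g a = 0"
    using real_poly_root_or_quadratic_factor[of g] Suc.hyps(2) by auto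
  then obtain h where h: "g = [:- a, 1:] * h" by (auto simp: poly_eq_0_iff_dvd elim: dvdE)
  have "h \<noteq> 0" using Suc.hyps(2) h by auto
  then have "degree g = Suc (degree h)" unfolding h by (subst degree_mult_eq) auto
  then obtain \<Lambda> c where \<Lambda>: "finite \<Lambda>" "h = smult c (\<Prod>a\<in>\<Lambda>. [:- a, 1:])"
    using Suc.hyps(1)[of h] Suc.hyps(2) Suc.prems h by (metis dvd_mult_right nat.inject)
  have "a \<notin> \<Lambda>"
  proof
    assume "a \<in> \<Lambda>"
    then have "[:- a, 1:] dvd h" using \<Lambda> by (auto intro!: dvd_smult)
    then have "[:- a, 1:] * [:- a, 1:] dvd g" unfolding h by (rule mult_dvd_mono[OF dvd_refl])
    then show False using noquad[of a 0] by (simp add: power2_eq_square)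
  qed
  then have "g = smult c (\<Prod>a\<in>insert a \<Lambda>. [:- a, 1:])"
    using \<Lambda> h by (simp add: algebra_simps)
  with \<Lambda>(1) show ?case by blast
qed

text \<open>
  The Lagrange polynomials of the roots of the minimal polynomial, evaluated at \<open>x\<close>, are the
  projections to its eigenvalues.
\<close>

lemma eigenvalue_idempotents_exist:
  "\<exists>\<Lambda> f. finite \<Lambda> \<and> (\<forall>a\<in>\<Lambda>. f a \<odot> f a = f a \<and> x \<odot> f a = a *\<^sub>R f a)
     \<and> (\<forall>a\<in>\<Lambda>. \<forall>b\<in>\<Lambda>. a \<noteq> b \<longrightarrow> f a \<odot> f b = 0) \<and> (\<Sum>a\<in>\<Lambda>. f a) = e"
proof -
  obtain p where p: "p \<noteq> 0" "peval x p = 0"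
    and min: "\<And>q. q \<noteq> 0 \<Longrightarrow> peval x q = 0 \<Longrightarrow> degree p \<le> degree q"
  proof -
    obtain p0 where "p0 \<noteq> 0 \<and> peval x p0 = 0" using annihilating_poly_exists[of x] by blast
    then obtain p where "p \<noteq> 0 \<and> peval x p = 0"
      "\<forall>q. q \<noteq> 0 \<and> peval x q = 0 \<longrightarrow> degree p \<le> degree q"
      using ex_has_least_nat[of "\<lambda>p. p \<noteq> 0 \<and> peval x p = 0" p0 degree] by (elim exE conjE) blast+
    then show ?thesis by (intro that[of p]) blast+
  qed
  obtain \<Lambda> k where \<Lambda>: "finite \<Lambda>" and pk: "p = smult k (\<Prod>a\<in>\<Lambda>. [:- a, 1:])"
    using minimal_annihilator_splits[OF min p dvd_refl] by blast
  have "k \<noteq> 0" using p(1) pk by auto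
  define P where "P = (\<Prod>a\<in>\<Lambda>. [:- a, 1:])"
  have P0: "peval x P = 0"
    using p(2) \<open>k \<noteq> 0\<close> by (simp add: pk P_def peval_smult)
  define lag where "lag = (\<lambda>a. smult (inverse (\<Prod>b\<in>\<Lambda> - {a}. a - b)) (\<Prod>b\<in>\<Lambda> - {a}. [:- b, 1::real:]))"
  define f where "f = (\<lambda>a. peval x (lag a))"
  have sum1: "(\<Sum>a\<in>\<Lambda>. f a) = e"
  proof (cases "\<Lambda> = {}")
    case True
    then show ?thesis using P0 by (simp add: P_def)
  next
    case False
    then show ?thesis
      using lagrange_sum_1[OF \<Lambda>] by (simp add: f_def lag_def flip: peval_sum)
  qed
  have x1: "peval x [:- a, 1:] = x - a *\<^sub>R e" for a
    by (simp add: peval_pCons)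
  have eig: "x \<odot> f a = a *\<^sub>R f a" if "a \<in> \<Lambda>" for a
  proof -
    have "[:- a, 1:] * lag a = smult (inverse (\<Prod>b\<in>\<Lambda> - {a}. a - b)) P"
      unfolding P_def lag_def prod.remove[OF \<Lambda> that] by (simp only: mult_smult_right)
    then have "(x - a *\<^sub>R e) \<odot> f a = 0"
      unfolding f_def x1[symmetric] peval_mult[symmetric] by (simp only: peval_smult P0 scaleR_zero_right)
    then show ?thesis by (simp add: J_distribs)
  qed
  have orth: "f a \<odot> f b = 0" if "a \<in> \<Lambda>" "b \<in> \<Lambda>" "a \<noteq> b" for a b
  proof -
    have assoc: "(u \<odot> v) \<odot> w = u \<odot> (v \<odot> w)"
      if "u \<in> range (peval x)" "v \<in> range (peval x)" "w \<in> range (peval x)" for u v w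
      using that by (auto simp: mult.assoc peval_mult[symmetric])
    have "x = peval x [:0, 1:]" by (simp add: peval_pCons)
    then have in_range: "x \<in> range (peval x)" "f a \<in> range (peval x)" "f b \<in> range (peval x)"
      by (auto simp: f_def)
    have "a *\<^sub>R (f a \<odot> f b) = (x \<odot> f a) \<odot> f b" by (simp add: eig that J_distribs)
    also have "\<dots> = x \<odot> (f a \<odot> f b)" using in_range by (rule assoc)
    also have "\<dots> = x \<odot> (f b \<odot> f a)" by (simp only: commute)
    also have "\<dots> = (x \<odot> f b) \<odot> f a" using in_range by (intro assoc[symmetric])
    also have "\<dots> = b *\<^sub>R (f a \<odot> f b)" by (simp add: eig that J_distribs commute[of "f b" "f a"])
    finally have "(a - b) *\<^sub>R (f a \<odot> f b) = 0" by (simp add: scaleR_diff_left)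
    with that show ?thesis by simp
  qed
  have idem: "f a \<odot> f a = f a" if "a \<in> \<Lambda>" for a
  proof -
    have "f a = f a \<odot> (\<Sum>b\<in>\<Lambda>. f b)" by (simp add: sum1)
    also have "\<dots> = (\<Sum>b\<in>\<Lambda>. if b = a then f a \<odot> f a else 0)"
      unfolding J_sum_right by (rule sum.cong) (auto simp: orth that)
    also have "\<dots> = f a \<odot> f a" using \<Lambda> that by simp
    finally show ?thesis by simp
  qed
  show ?thesis
    by (intro exI[of _ \<Lambda>] exI[of _ f] conjI ballI impI) (fact \<Lambda> sum1 eig orth idem)+
qed

text \<open>
  Frames whose members may still be split; a maximal refinement is a Jordan frame.
\<close>

definition orthogonal_idempotents :: "'a set \<Rightarrow> bool" where
  "orthogonal_idempotents C \<longleftrightarrow> finite C \<and> (\<forall>c\<in>C. c \<odot> c = c \<and> c \<noteq> 0) \<and>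
     (\<forall>c\<in>C. \<forall>d\<in>C. c \<noteq> d \<longrightarrow> c \<odot> d = 0) \<and> (\<Sum>c\<in>C. c) = e"

lemma orthogonal_idempotents_independent:
  assumes "orthogonal_idempotents C"
  shows "independent C"
proof (rule independent_if_scalars_zero)
  show fin: "finite C" using assms by (simp add: orthogonal_idempotents_def)
  fix k c assume z: "(\<Sum>d\<in>C. k d *\<^sub>R d) = 0" and c: "c \<in> C"
  have "0 = c \<odot> (\<Sum>d\<in>C. k d *\<^sub>R d)" by (simp add: z)
  also have "\<dots> = (\<Sum>d\<in>C. if d = c then k c *\<^sub>R c else 0)"
    unfolding J_sum_right
    by (rule sum.cong) (use assms c in \<open>auto simp: J_distribs orthogonal_idempotents_def\<close>)
  also have "\<dots> = k c *\<^sub>R c" using fin c by simp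
  finally show "k c = 0" using assms c by (auto simp: orthogonal_idempotents_def)
qed

lemma orthogonal_idempotents_expansion_exists:
  "\<exists>C l. orthogonal_idempotents C \<and> x = (\<Sum>c\<in>C. l c *\<^sub>R c)"
proof -
  obtain \<Lambda> f where fin: "finite \<Lambda>" and idem: "\<And>a. a \<in> \<Lambda> \<Longrightarrow> f a \<odot> f a = f a"
    and eig: "\<And>a. a \<in> \<Lambda> \<Longrightarrow> x \<odot> f a = a *\<^sub>R f a"
    and orth: "\<And>a b. a \<in> \<Lambda> \<Longrightarrow> b \<in> \<Lambda> \<Longrightarrow> a \<noteq> b \<Longrightarrow> f a \<odot> f b = 0"
    and sum1: "(\<Sum>a\<in>\<Lambda>. f a) = e"
    using eigenvalue_idempotents_exist[of x] by blast
  define \<Lambda>' where "\<Lambda>' = {a \<in> \<Lambda>. f a \<noteq> 0}"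
  have \<Lambda>': "finite \<Lambda>'" "\<And>a. a \<in> \<Lambda>' \<Longrightarrow> a \<in> \<Lambda>" "\<And>a. a \<in> \<Lambda>' \<Longrightarrow> f a \<noteq> 0"
    using fin by (auto simp: \<Lambda>'_def)
  have inj: "inj_on f \<Lambda>'"
    using orth idem \<Lambda>' by (intro inj_onI) metis
  \<comment> \<open>Some projections may vanish; a frame is a set of nonzero elements.\<close>
  have s: "(\<Sum>a\<in>\<Lambda>'. g a *\<^sub>R f a) = (\<Sum>a\<in>\<Lambda>. g a *\<^sub>R f a)" for g
    using fin by (intro sum.mono_neutral_left) (auto simp: \<Lambda>'_def)
  define l where "l = the_inv_into \<Lambda>' f"
  have l: "l (f a) = a" if "a \<in> \<Lambda>'" for a
    using that inj by (simp add: l_def the_inv_into_f_f)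
  have "x = x \<odot> (\<Sum>a\<in>\<Lambda>. f a)" by (simp add: sum1)
  also have "\<dots> = (\<Sum>a\<in>\<Lambda>. a *\<^sub>R f a)"
    unfolding J_sum_right by (rule sum.cong) (auto simp: eig)
  also have "\<dots> = (\<Sum>c\<in>f ` \<Lambda>'. l c *\<^sub>R c)"
    by (simp add: sum.reindex[OF inj] l flip: s)
  finally have "x = (\<Sum>c\<in>f ` \<Lambda>'. l c *\<^sub>R c)" .
  moreover have "f a \<odot> f b = 0" if "a \<in> \<Lambda>'" "b \<in> \<Lambda>'" "f a \<noteq> f b" for a b
    using that orth \<Lambda>'(2) by metis
  then have "orthogonal_idempotents (f ` \<Lambda>')"
    unfolding orthogonal_idempotents_def
    using \<Lambda>' idem sum1 s[of "\<lambda>_. 1"] by (auto simp: sum.reindex[OF inj])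
  ultimately show ?thesis by blast
qed

text \<open>
  The values of the form at two idempotents are nonnegative, so neither summand can contribute.
  This keeps a system orthogonal when one of its members is split.
\<close>

lemma orthogonal_summand:
  assumes idem: "a \<odot> a = a" "b \<odot> b = b" "d \<odot> d = d" and "(a + b) \<odot> d = 0"
  shows "a \<odot> d = 0"
proof -
  have "form a d + form b d = form (a + b) d" by (simp add: form_distribs)
  also have "\<dots> = form ((a + b) \<odot> d) e"
    using form_assoc[of d "a + b" e] form_assoc[of "a + b" d e] by (simp add: commute)
  finally have "form a d + form b d = 0" using assms(4) by simp
  then have "form a d = 0"
    using idempotents_form_nonneg[of a d] idempotents_form_nonneg[of b d] idem by linarith
  then show ?thesis using idempotents_orthogonal_iff[of a d] idem by simp
qed

lemma refine_orthogonal_idempotents: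
  assumes C: "orthogonal_idempotents C" and c: "c \<in> C"
    and ab: "a \<odot> a = a" "b \<odot> b = b" "a \<noteq> 0" "b \<noteq> 0" "c = a + b"
    and x: "x = (\<Sum>c\<in>C. l c *\<^sub>R c)"
  shows "\<exists>C' l'. orthogonal_idempotents C' \<and> x = (\<Sum>c\<in>C'. l' c *\<^sub>R c) \<and> card C' = Suc (card C)"
proof -
  let ?R = "C - {c}"
  have Cd: "finite C" "\<And>c. c \<in> C \<Longrightarrow> c \<odot> c = c \<and> c \<noteq> 0"
    "\<And>c d. c \<in> C \<Longrightarrow> d \<in> C \<Longrightarrow> c \<noteq> d \<Longrightarrow> c \<odot> d = 0" "(\<Sum>c\<in>C. c) = e"
    using C by (auto simp: orthogonal_idempotents_def)
  have "(a + b) \<odot> (a + b) = a + b" using Cd(2)[OF c] ab(5) by simp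
  then have "a \<odot> b + a \<odot> b = 0" using ab by (simp add: J_distribs commute[of b a])
  then have "2 *\<^sub>R (a \<odot> b) = 0" by (simp add: scaleR_2)
  then have ab0: "a \<odot> b = 0" by simp
  have a0: "a \<odot> d = 0" if "d \<in> ?R" for d
    using orthogonal_summand[of a b d] ab Cd(2)[of d] Cd(3)[of c d] c that by auto
  have b0: "b \<odot> d = 0" if "d \<in> ?R" for d
    using orthogonal_summand[of b a d] ab Cd(2)[of d] Cd(3)[of c d] c that by (auto simp: add.commute)
  have new: "a \<notin> ?R" "b \<notin> ?R" "a \<noteq> b"
    using a0[of a] b0[of b] ab(1-4) ab0 by auto
  define l' where "l' = (\<lambda>d. if d = a \<or> d = b then l c else l d)"
  have "x = l c *\<^sub>R c + (\<Sum>d\<in>?R. l d *\<^sub>R d)"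
    using x sum.remove[OF Cd(1) c] by simp
  moreover have "(\<Sum>d\<in>?R. l d *\<^sub>R d) = (\<Sum>d\<in>?R. l' d *\<^sub>R d)"
    using new by (intro sum.cong) (auto simp: l'_def)
  ultimately have "x = (\<Sum>d\<in>insert a (insert b ?R). l' d *\<^sub>R d)"
    using new Cd(1) by (simp add: l'_def ab(5) scaleR_add_right add.assoc)
  moreover have "orthogonal_idempotents (insert a (insert b ?R))"
    unfolding orthogonal_idempotents_def
  proof (intro conjI)
    show "(\<Sum>d\<in>insert a (insert b ?R). d) = e"
    proof -
      have "(\<Sum>d\<in>insert a (insert b ?R). d) = a + (b + (\<Sum>d\<in>?R. d))" using new Cd(1) by simp
      also have "\<dots> = c + (\<Sum>d\<in>?R. d)" by (simp add: ab(5) add.assoc)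
      also have "\<dots> = e" using sum.remove[OF Cd(1) c, of "\<lambda>d. d"] Cd(4) by simp
      finally show ?thesis .
    qed
    show "\<forall>c\<in>insert a (insert b ?R). \<forall>d\<in>insert a (insert b ?R). c \<noteq> d \<longrightarrow> c \<odot> d = 0"
    proof (intro ballI impI)
      fix c' d assume "c' \<in> insert a (insert b ?R)" "d \<in> insert a (insert b ?R)" "c' \<noteq> d"
      then show "c' \<odot> d = 0"
        using Cd(3)[of c' d] ab0 a0[of c'] a0[of d] b0[of c'] b0[of d] commute[of c' d]
          commute[of a b] by auto
    qed
    show "finite (insert a (insert b ?R))" using Cd(1) by simp
    show "\<forall>d\<in>insert a (insert b ?R). d \<odot> d = d \<and> d \<noteq> 0"
      using Cd(2) ab(1-4) by blast
  qed
  moreover have "card (insert a (insert b ?R)) = Suc (card C)"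
    using new Cd(1) card_Suc_Diff1[OF Cd(1) c] by simp
  ultimately show ?thesis by blast
qed

text \<open>
  A system of orthogonal idempotents is independent, so among those that diagonalise \<open>x\<close> one has
  maximal cardinality. Splitting a member that is not primitive would enlarge it.
\<close>

theorem spectral_decomposition_exists: "\<exists>C l. spectral_decomposition J e x C l"
proof -
  let ?P = "\<lambda>C. orthogonal_idempotents C \<and> (\<exists>l. x = (\<Sum>c\<in>C. l c *\<^sub>R c))"
  obtain N where "\<And>C::'a set. independent C \<Longrightarrow> finite C \<and> card C \<le> N"
    using independent_card_bound by blast
  then have "\<forall>C. ?P C \<longrightarrow> card C < Suc N"
    using orthogonal_idempotents_independent by (meson le_imp_less_Suc)
  then obtain C where C: "?P C" and max: "\<And>D. ?P D \<Longrightarrow> card D \<le> card C"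
    using ex_has_greatest_nat[of ?P _ card "Suc N"] orthogonal_idempotents_expansion_exists[of x] by blast
  then obtain l where l: "x = (\<Sum>c\<in>C. l c *\<^sub>R c)" by blast
  have "primitive_idempotent J c" if c: "c \<in> C" for c
  proof (rule ccontr)
    assume "\<not> primitive_idempotent J c"
    then obtain a b where "a \<odot> a = a" "b \<odot> b = b" "a \<noteq> 0" "b \<noteq> 0" "c = a + b"
      using C c by (auto simp: primitive_idempotent_def orthogonal_idempotents_def)
    then obtain C' l' where "?P C'" "card C' = Suc (card C)"
      using refine_orthogonal_idempotents[OF _ c _ _ _ _ _ l, of a b] C by blast
    with max show False by fastforce
  qed
  with C l show ?thesis
    by (auto simp: spectral_decomposition_def jordan_frame_def orthogonal_idempotents_def)
qed

section \<open>The trace\<close>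

lemma spectral_decompositionD:
  assumes "spectral_decomposition J e x C l"
  shows "jordan_frame J e C" "finite C" "(\<Sum>c\<in>C. c) = e" "x = (\<Sum>c\<in>C. l c *\<^sub>R c)"
    and "\<And>c. c \<in> C \<Longrightarrow> primitive_idempotent J c"
  using assms by (auto simp: spectral_decomposition_def jordan_frame_def)

lemma primitive_idempotentD: "primitive_idempotent J c \<Longrightarrow> c \<odot> c = c" "primitive_idempotent J c \<Longrightarrow> c \<noteq> 0"
  by (auto simp: primitive_idempotent_def)

lemma frame_mult_element:
  assumes "jordan_frame J e C" "c \<in> C"
  shows "(\<Sum>d\<in>C. l d *\<^sub>R d) \<odot> c = l c *\<^sub>R c"
proof -
  have "(\<Sum>d\<in>C. l d *\<^sub>R d) \<odot> c = (\<Sum>d\<in>C. if d = c then l c *\<^sub>R c else 0)"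
    unfolding J_sum_left using assms
    by (intro sum.cong) (auto simp: J_distribs jordan_frame_def primitive_idempotent_def)
  also have "\<dots> = l c *\<^sub>R c" using assms by (simp add: jordan_frame_def)
  finally show ?thesis .
qed

lemma frame_mult:
  assumes "jordan_frame J e C"
  shows "(\<Sum>c\<in>C. l c *\<^sub>R c) \<odot> (\<Sum>c\<in>C. m c *\<^sub>R c) = (\<Sum>c\<in>C. (l c * m c) *\<^sub>R c)"
  unfolding J_sum_right[of _ _ C]
  by (rule sum.cong) (auto simp: J_distribs frame_mult_element[OF assms])

text \<open>
  Diagonalise \<open>x\<close> by a frame. Every member \<open>d\<close> with nonzero eigenvalue is orthogonal to \<open>e - c\<close>,
  because the form of \<open>e - c\<close> with \<open>x x\<close> vanishes and is a sum of nonnegative terms. Hence \<open>d\<close> is a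
  summand of \<open>c\<close>, and equals \<open>c\<close> by primitivity.
\<close>

lemma primitive_peirce_one:
  assumes prim: "primitive_idempotent J c" and cx: "c \<odot> x = x"
  shows "\<exists>k. x = k *\<^sub>R c"
proof -
  have cc: "c \<odot> c = c" using prim by (rule primitive_idempotentD)
  have ec: "(e - c) \<odot> (e - c) = e - c" by (simp add: J_distribs cc)
  obtain C l where dec: "spectral_decomposition J e x C l"
    using spectral_decomposition_exists by blast
  note C = spectral_decompositionD[OF dec]
  have xx: "x \<odot> x = (\<Sum>d\<in>C. (l d * l d) *\<^sub>R d)"
    using frame_mult[OF C(1), of l l] C(4) by simp
  have nonneg: "form (e - c) d \<ge> 0" if "d \<in> C" for d
    using idempotents_form_nonneg ec C(5)[OF that] primitive_idempotentD by blast
  have "(\<Sum>d\<in>C. (l d * l d) * form (e - c) d) = form (e - c) (x \<odot> x)"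
    unfolding xx form_sum_right by (simp add: form_distribs)
  also have "\<dots> = form (x \<odot> (e - c)) x" by (simp add: form_assoc)
  also have "x \<odot> (e - c) = 0" by (simp add: J_distribs commute[of x c] cx)
  finally have "(\<Sum>d\<in>C. (l d * l d) * form (e - c) d) = 0" by simp
  then have zero: "(l d * l d) * form (e - c) d = 0" if "d \<in> C" for d
    using that nonneg C(2) by (subst (asm) sum_nonneg_eq_0_iff) auto
  have only_c: "d = c" if d: "d \<in> C" "l d \<noteq> 0" for d
  proof -
    have dd: "d \<odot> d = d" "d \<noteq> 0" using C(5)[OF d(1)] primitive_idempotentD by auto
    have "form (e - c) d = 0" using zero[OF d(1)] d(2) by simp
    then have "(e - c) \<odot> d = 0" using idempotents_orthogonal_iff[OF ec dd(1)] by simp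
    then have cd: "c \<odot> d = d" by (simp add: J_distribs)
    then have "(c - d) \<odot> (c - d) = c - d" by (simp add: J_distribs cc dd commute[of d c])
    moreover have "c = d + (c - d)" by simp
    ultimately have "c - d = 0" using prim dd unfolding primitive_idempotent_def by blast
    then show ?thesis by simp
  qed
  have "x = (\<Sum>d\<in>C. if d = c then l c *\<^sub>R c else 0)"
    unfolding C(4) by (rule sum.cong) (use only_c in auto)
  also have "\<dots> = (if c \<in> C then l c else 0) *\<^sub>R c" using C(2) by simp
  finally show ?thesis by blast
qed

text \<open>
  The first equation says that the Peirce projection to the one-dimensional 1-space of \<open>c\<close> sends
  \<open>x\<close> to \<open>k c\<close>.
\<close>

lemma primitive_compression:
  assumes "primitive_idempotent J c"
  obtains k where "2 *\<^sub>R (c \<odot> (c \<odot> x)) = c \<odot> x + k *\<^sub>R c" "form c x = k * form c c"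
proof -
  have cc: "c \<odot> c = c" using assms by (rule primitive_idempotentD)
  define y where "y = 2 *\<^sub>R (c \<odot> (c \<odot> x)) - c \<odot> x"
  have "c \<odot> y = 2 *\<^sub>R (c \<odot> (c \<odot> (c \<odot> x))) - c \<odot> (c \<odot> x)"
    by (simp add: y_def J_distribs)
  also have "\<dots> = 3 *\<^sub>R (c \<odot> (c \<odot> x)) - c \<odot> x - c \<odot> (c \<odot> x)"
    by (simp add: idempotent_cubic[OF cc])
  also have "\<dots> = y"
    unfolding y_def using scaleR_add_left[of 2 1 "c \<odot> (c \<odot> x)"] by simp
  finally have "c \<odot> y = y" .
  then obtain k where k: "y = k *\<^sub>R c" using primitive_peirce_one[OF assms] by blast
  have step: "form c (c \<odot> z) = form c z" for z using form_assoc[of c c z] cc by simp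
  have "k * form c c = form c y" by (simp add: k form_distribs)
  also have "\<dots> = form c x" by (simp add: y_def form_distribs step)
  finally have "form c x = k * form c c" by simp
  moreover have "2 *\<^sub>R (c \<odot> (c \<odot> x)) = c \<odot> x + k *\<^sub>R c"
    using k by (simp add: y_def algebra_simps)
  ultimately show thesis by (rule that[rotated])
qed

text \<open>
  Let \<open>x = c d\<close>, and let \<open>a c\<close> and \<open>b d\<close> be the compressions of \<open>d\<close> to \<open>c\<close> and of \<open>c\<close> to \<open>d\<close>.
  The linearised Jordan identity expresses \<open>x x\<close> through \<open>x\<close>, \<open>c\<close> and \<open>d\<close>, and doing so with the
  roles of \<open>c\<close> and \<open>d\<close> exchanged gives the same result with \<open>a\<close> and \<open>b\<close> exchanged in the
  coefficient of \<open>x\<close>. As \<open>x \<noteq> 0\<close>, \<open>a = b\<close>; and \<open>a |c|\<^sup>2\<close> and \<open>b |d|\<^sup>2\<close> both equal the form at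
  \<open>c\<close> and \<open>d\<close>. This replaces the decomposition into simple ideals, on each of which the
  form is a multiple of the trace form.
\<close>

lemma nonorthogonal_primitives_same_norm:
  assumes c: "primitive_idempotent J c" and d: "primitive_idempotent J d" and "c \<odot> d \<noteq> 0"
  shows "form c c = form d d"
proof -
  define x where "x = c \<odot> d"
  have cc: "c \<odot> c = c" and dd: "d \<odot> d = d" using c d primitive_idempotentD by auto
  obtain a where a: "2 *\<^sub>R (c \<odot> x) = x + a *\<^sub>R c" "form c d = a * form c c"
    using primitive_compression[OF c, of d] unfolding x_def .
  obtain b where b: "2 *\<^sub>R (d \<odot> x) = x + b *\<^sub>R d" "form d c = b * form d d"
    using primitive_compression[OF d, of c] unfolding x_def commute[of c d] .
  have key: "4 *\<^sub>R (x \<odot> x) = (2 * b) *\<^sub>R x + (a *\<^sub>R c + b *\<^sub>R d)"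
    if lin: "d \<odot> x - x + 2 *\<^sub>R (c \<odot> (d \<odot> x) - x \<odot> x) = 0"
      and a: "2 *\<^sub>R (c \<odot> x) = x + a *\<^sub>R c" and b: "2 *\<^sub>R (d \<odot> x) = x + b *\<^sub>R d"
      and x: "c \<odot> d = x" for c d a b
  proof -
    have "2 *\<^sub>R (c \<odot> (d \<odot> x)) = c \<odot> (2 *\<^sub>R (d \<odot> x))" by (simp add: J_distribs)
    also have "\<dots> = c \<odot> x + b *\<^sub>R x" by (simp add: b J_distribs x)
    finally have "2 *\<^sub>R (x \<odot> x) = d \<odot> x - x + c \<odot> x + b *\<^sub>R x"
      using lin by (simp add: algebra_simps)
    then have "2 *\<^sub>R (2 *\<^sub>R (x \<odot> x)) = 2 *\<^sub>R (d \<odot> x - x + c \<odot> x + b *\<^sub>R x)"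
      by (simp only:)
    also have "\<dots> = 2 *\<^sub>R (d \<odot> x) - 2 *\<^sub>R x + 2 *\<^sub>R (c \<odot> x) + 2 *\<^sub>R (b *\<^sub>R x)"
      by (simp only: scaleR_add_right scaleR_diff_right)
    also have "\<dots> = (2 * b) *\<^sub>R x + (a *\<^sub>R c + b *\<^sub>R d)"
      unfolding a b by (simp add: scaleR_2)
    finally show ?thesis by simp
  qed
  have "d \<odot> x - x + 2 *\<^sub>R (c \<odot> (d \<odot> x) - x \<odot> x) = 0"
    using jordan_linearised[of d c d] by (simp add: cc dd x_def commute[of "c \<odot> d" d] commute[of d c])
  then have 1: "4 *\<^sub>R (x \<odot> x) = (2 * b) *\<^sub>R x + (a *\<^sub>R c + b *\<^sub>R d)"
    using a(1) b(1) x_def by (intro key) auto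
  have "c \<odot> x - x + 2 *\<^sub>R (d \<odot> (c \<odot> x) - x \<odot> x) = 0"
    using jordan_linearised[of c d c] by (simp add: cc dd x_def commute[of "c \<odot> d" c] commute[of d c])
  then have 2: "4 *\<^sub>R (x \<odot> x) = (2 * a) *\<^sub>R x + (b *\<^sub>R d + a *\<^sub>R c)"
    using a(1) b(1) x_def commute[of d c] by (intro key) auto
  have "(2 * b) *\<^sub>R x + (a *\<^sub>R c + b *\<^sub>R d) = (2 * a) *\<^sub>R x + (a *\<^sub>R c + b *\<^sub>R d)"
    using 1 2 by (simp only: add.commute[of "b *\<^sub>R d"])
  then have "(2 * b) *\<^sub>R x = (2 * a) *\<^sub>R x" by (simp only: add_right_cancel)
  then have "a = b" using assms(3) by (auto simp: x_def)
  moreover have "form c d \<noteq> 0"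
    using assms(3) idempotents_orthogonal_iff[OF cc dd] by simp
  ultimately show ?thesis
    using a(2) b(2) form_sym[of c d] by auto
qed

text \<open>
  The element that represents the trace in the form. It rescales the form on each simple ideal so
  that primitive idempotents get length one.
\<close>

definition trace_weight :: 'a where
  "trace_weight = (\<Sum>c\<in>(SOME C. jordan_frame J e C). inverse (form c c) *\<^sub>R c)"

text \<open>
  Members of the frame that are not orthogonal to \<open>d\<close> have the norm of \<open>d\<close>, so their weight can be
  replaced by that of \<open>d\<close>, and the frame sums to \<open>e\<close>.
\<close>

lemma trace_weight_primitive:
  assumes d: "primitive_idempotent J d"
  shows "trace_weight \<odot> d = inverse (form d d) *\<^sub>R d"
proof -
  define C where "C = (SOME C. jordan_frame J e C)"
  have "\<exists>C. jordan_frame J e C"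
    using spectral_decomposition_exists[of e] spectral_decompositionD(1) by blast
  then have C: "jordan_frame J e C" unfolding C_def by (rule someI_ex)
  have "trace_weight \<odot> d = (\<Sum>c\<in>C. inverse (form c c) *\<^sub>R (c \<odot> d))"
    by (simp add: trace_weight_def C_def J_sum_left J_distribs)
  also have "\<dots> = (\<Sum>c\<in>C. inverse (form d d) *\<^sub>R (c \<odot> d))"
  proof (rule sum.cong)
    fix c assume "c \<in> C"
    then have "primitive_idempotent J c" using C by (simp add: jordan_frame_def)
    then show "inverse (form c c) *\<^sub>R (c \<odot> d) = inverse (form d d) *\<^sub>R (c \<odot> d)"
      using nonorthogonal_primitives_same_norm[OF _ d] by (cases "c \<odot> d = 0") auto
  qed simp
  also have "\<dots> = inverse (form d d) *\<^sub>R ((\<Sum>c\<in>C. c) \<odot> d)"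
    by (simp add: J_sum_left scaleR_sum_right)
  finally show ?thesis using C by (simp add: jordan_frame_def)
qed

lemma eq_0_if_form_primitives_0:
  assumes "\<And>d. primitive_idempotent J d \<Longrightarrow> form y d = 0"
  shows "y = 0"
proof -
  obtain C l where dec: "spectral_decomposition J e y C l"
    using spectral_decomposition_exists by blast
  note C = spectral_decompositionD[OF dec]
  have "form y (\<Sum>d\<in>C. l d *\<^sub>R d) = 0"
    unfolding form_sum_right by (rule sum.neutral) (use assms C(5) in \<open>auto simp: form_distribs\<close>)
  then show ?thesis by (simp flip: C(4))
qed

text \<open>
  Centrality is what makes the trace form associative. It suffices to test with primitive
  idempotents \<open>b\<close> and \<open>d\<close>: the two sides differ by the factor \<open>|d|\<^sup>2 / |b|\<^sup>2\<close>, which is 1 unless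
  \<open>b d = 0\<close>, and then both vanish.
\<close>

lemma trace_weight_central: "trace_weight \<odot> (a \<odot> b) = a \<odot> (trace_weight \<odot> b)"
proof -
  have prim: "trace_weight \<odot> (a \<odot> b) = a \<odot> (trace_weight \<odot> b)" if b: "primitive_idempotent J b" for b
  proof -
    have "form (trace_weight \<odot> (a \<odot> b) - a \<odot> (trace_weight \<odot> b)) d = 0"
      if d: "primitive_idempotent J d" for d
    proof -
      have 1: "form (trace_weight \<odot> (a \<odot> b)) d = inverse (form d d) * form (a \<odot> b) d"
        by (simp add: form_assoc trace_weight_primitive[OF d] form_distribs)
      have 2: "form (a \<odot> (trace_weight \<odot> b)) d = inverse (form b b) * form (a \<odot> b) d"
        by (simp add: trace_weight_primitive[OF b] form_distribs J_distribs)
      have "form (a \<odot> b) d = form a (b \<odot> d)" by (simp add: commute[of a b] form_assoc)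
      then show ?thesis
        using nonorthogonal_primitives_same_norm[OF b d] 1 2
        by (cases "b \<odot> d = 0") (auto simp: form_distribs)
    qed
    then show ?thesis using eq_0_if_form_primitives_0 by (metis eq_iff_diff_eq_0)
  qed
  obtain C l where dec: "spectral_decomposition J e b C l"
    using spectral_decomposition_exists by blast
  note C = spectral_decompositionD[OF dec]
  show ?thesis
    unfolding C(4) J_sum_right by (rule sum.cong) (auto simp: J_distribs prim C(5))
qed

abbreviation tr :: "'a \<Rightarrow> real" where "tr \<equiv> jordan_tr J e"
abbreviation ip :: "'a \<Rightarrow> 'a \<Rightarrow> real" where "ip \<equiv> jordan_inner J e"

lemma form_trace_weight_primitive:
  assumes "primitive_idempotent J c"
  shows "form c trace_weight = 1"
proof -
  have "form c trace_weight = form (trace_weight \<odot> c) e"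
    by (simp add: form_assoc)
  also have "\<dots> = inverse (form c c) * form c e"
    by (simp add: trace_weight_primitive[OF assms] form_distribs)
  also have "form c e = form c c"
    using form_assoc[of c c e] primitive_idempotentD(1)[OF assms] by simp
  finally show ?thesis using form_pos[of c] primitive_idempotentD(2)[OF assms] by simp
qed

lemma spectral_trace:
  assumes "spectral_decomposition J e x C l"
  shows "(\<Sum>c\<in>C. l c) = form x trace_weight"
  using spectral_decompositionD[OF assms]
  by (simp add: form_sum_left form_distribs form_trace_weight_primitive)

text \<open>
  The sum of the eigenvalues depends on the element only, and linearly, because it is the form with
  a fixed element in every spectral decomposition.
\<close>

lemma tr_eq_form: "tr x = form x trace_weight"
proof -
  obtain C l where "spectral_decomposition J e x C l"
    using spectral_decomposition_exists by blast
  then show ?thesis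
    unfolding jordan_tr_def using spectral_trace by (intro the_equality) (metis, metis)
qed

lemmas tr_spectral = spectral_trace[folded tr_eq_form]

lemma tr_primitive: "primitive_idempotent J c \<Longrightarrow> tr c = 1"
  by (simp add: tr_eq_form form_trace_weight_primitive)

lemma tr_add: "tr (x + y) = tr x + tr y" and tr_diff: "tr (x - y) = tr x - tr y"
  and tr_scaleR: "tr (k *\<^sub>R x) = k * tr x" and tr_minus: "tr (- x) = - tr x"
  and tr_0 [simp]: "tr 0 = 0"
  by (simp_all add: tr_eq_form form_distribs)

lemma ip_sym: "ip x y = ip y x"
  by (simp add: jordan_inner_def commute)

lemma ip_distribs:
  "ip (x + y) z = ip x z + ip y z" "ip z (x + y) = ip z x + ip z y"
  "ip (x - y) z = ip x z - ip y z" "ip z (x - y) = ip z x - ip z y"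
  "ip (k *\<^sub>R x) z = k * ip x z" "ip z (k *\<^sub>R x) = k * ip z x"
  "ip (- x) z = - ip x z" "ip z (- x) = - ip z x"
  by (simp_all add: jordan_inner_def J_distribs tr_add tr_diff tr_scaleR tr_minus)

lemma ip_0 [simp]: "ip 0 z = 0" "ip z 0 = 0"
  by (simp_all add: jordan_inner_def)

lemma ip_sum_left: "ip (\<Sum>i\<in>A. f i) z = (\<Sum>i\<in>A. ip (f i) z)"
  by (induction A rule: infinite_finite_induct) (auto simp: ip_distribs)

lemma ip_sum_right: "ip z (\<Sum>i\<in>A. f i) = (\<Sum>i\<in>A. ip z (f i))"
  by (induction A rule: infinite_finite_induct) (auto simp: ip_distribs)

lemma ip_e [simp]: "ip x e = tr x" "ip e x = tr x"
  by (simp_all add: jordan_inner_def)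

lemma ip_assoc: "ip (a \<odot> b) c = ip b (a \<odot> c)"
proof -
  have "form ((a \<odot> b) \<odot> c) trace_weight = form c (trace_weight \<odot> (a \<odot> b))"
    by (simp only: form_assoc[of "a \<odot> b" c] commute[of trace_weight])
  also have "\<dots> = form (a \<odot> c) (trace_weight \<odot> b)"
    by (simp add: trace_weight_central form_assoc)
  also have "\<dots> = form (b \<odot> (a \<odot> c)) trace_weight"
    by (simp add: form_assoc commute[of b trace_weight])
  finally show ?thesis by (simp add: jordan_inner_def tr_eq_form)
qed

lemma ip_primitives_nonneg:
  assumes "primitive_idempotent J c" "primitive_idempotent J d"
  shows "ip c d \<ge> 0"
proof -
  have "ip c d = form d (trace_weight \<odot> c)"
    by (simp add: jordan_inner_def tr_eq_form form_assoc commute)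
  also have "\<dots> = inverse (form c c) * form d c"
    by (simp add: trace_weight_primitive[OF assms(1)] form_distribs)
  finally show ?thesis
    using idempotents_form_nonneg[of d c] assms primitive_idempotentD form_self_nonneg[of c] by simp
qed

lemma ip_pos: "x \<noteq> 0 \<Longrightarrow> ip x x > 0"
proof -
  assume "x \<noteq> 0"
  obtain C l where dec: "spectral_decomposition J e x C l"
    using spectral_decomposition_exists by blast
  note C = spectral_decompositionD[OF dec]
  have "x \<odot> x = (\<Sum>c\<in>C. (l c * l c) *\<^sub>R c)"
    using frame_mult[OF C(1), of l l] C(4) by simp
  then have "spectral_decomposition J e (x \<odot> x) C (\<lambda>c. l c * l c)"
    using C(1) by (simp add: spectral_decomposition_def)
  then have "ip x x = (\<Sum>c\<in>C. l c * l c)"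
    by (simp add: jordan_inner_def tr_spectral)
  moreover obtain c where "c \<in> C" "l c \<noteq> 0"
    using \<open>x \<noteq> 0\<close> C(4) by (metis (no_types, lifting) scaleR_eq_0_iff sum.neutral)
  moreover have "l c * l c > 0" using \<open>l c \<noteq> 0\<close> by (simp add: zero_less_mult_iff) linarith
  ultimately show ?thesis
    using C(2) sum_pos2[of C c "\<lambda>c. l c * l c"] by simp
qed

lemma ip_eq_0_iff: "ip x x = 0 \<longleftrightarrow> x = 0"
  using ip_pos[of x] by fastforce

text \<open>
  For two frames, the matrix of the trace form is thus doubly stochastic; with
  \<open>eigenvalues_match\<close> this makes functional calculus independent of choices.
\<close>

lemma ip_frame_row:
  assumes "jordan_frame J e D" "primitive_idempotent J c"
  shows "(\<Sum>d\<in>D. ip c d) = 1"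
  using assms by (simp add: jordan_frame_def tr_primitive flip: ip_sum_right)

lemma card_frame: "jordan_frame J e C \<Longrightarrow> real (card C) = tr e"
  using tr_spectral[of e C "\<lambda>_. 1"] by (simp add: spectral_decomposition_def jordan_frame_def)

lemma rank_eq_tr: "real (jordan_rank J e) = tr e"
proof -
  obtain C where C: "jordan_frame J e C"
    using spectral_decomposition_exists[of e] spectral_decompositionD(1) by blast
  then have "jordan_rank J e = card C"
    unfolding jordan_rank_def using card_frame by (intro the_equality) (auto, metis of_nat_eq_iff)
  then show ?thesis using card_frame[OF C] by simp
qed

section \<open>Functional calculus and positive elements\<close>

text \<open>
  Multiplication by \<open>x\<close> is symmetric, so eigenvectors for different eigenvalues are orthogonal.
\<close>

lemma eigenvalues_match:
  assumes "spectral_decomposition J e x C l" "spectral_decomposition J e x D m" "c \<in> C" "d \<in> D"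
  shows "h (l c) * ip c d = h (m d) * ip c d"
proof -
  note C = spectral_decompositionD[OF assms(1)] and D = spectral_decompositionD[OF assms(2)]
  have "x \<odot> c = l c *\<^sub>R c" "x \<odot> d = m d *\<^sub>R d"
    using frame_mult_element[OF C(1) assms(3), of l] frame_mult_element[OF D(1) assms(4), of m]
    by (simp_all flip: C(4) D(4))
  then have "l c * ip c d = m d * ip c d"
    using ip_assoc[of x c d] by (simp add: ip_distribs)
  then show ?thesis by auto
qed

lemma ip_frame_element:
  assumes "jordan_frame J e C" "c \<in> C"
  shows "ip (\<Sum>d\<in>C. l d *\<^sub>R d) c = l c"
  using assms by (simp add: jordan_inner_def frame_mult_element tr_scaleR tr_primitive jordan_frame_def)

lemma ip_functional_calculus:
  assumes "spectral_decomposition J e x C l" "spectral_decomposition J e x D m" "d \<in> D"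
  shows "ip (\<Sum>c\<in>C. g (l c) *\<^sub>R c) d = g (m d)"
proof -
  note C = spectral_decompositionD[OF assms(1)] and D = spectral_decompositionD[OF assms(2)]
  have "ip (\<Sum>c\<in>C. g (l c) *\<^sub>R c) d = (\<Sum>c\<in>C. g (m d) * ip d c)"
    unfolding ip_sum_left using eigenvalues_match[OF assms(1,2) _ assms(3), of _ g]
    by (intro sum.cong) (auto simp: ip_distribs ip_sym[of d])
  also have "\<dots> = g (m d)"
    using ip_frame_row[OF C(1) D(5)[OF assms(3)]] by (simp flip: sum_distrib_left)
  finally show ?thesis .
qed

text \<open>
  The difference of the two sides is orthogonal to both frames, and itself a combination of them.
\<close>

lemma functional_calculus_unique:
  assumes "spectral_decomposition J e x C l" "spectral_decomposition J e x D m"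
  shows "(\<Sum>c\<in>C. g (l c) *\<^sub>R c) = (\<Sum>d\<in>D. g (m d) *\<^sub>R d)" (is "?X = ?Y")
proof -
  note C = spectral_decompositionD[OF assms(1)] and D = spectral_decompositionD[OF assms(2)]
  have D0: "ip (?X - ?Y) d = 0" if "d \<in> D" for d
    using ip_functional_calculus[OF assms that, of g] ip_frame_element[OF D(1) that, of "\<lambda>d. g (m d)"]
    by (simp add: ip_distribs)
  have C0: "ip (?X - ?Y) c = 0" if "c \<in> C" for c
    using ip_functional_calculus[OF assms(2,1) that, of g] ip_frame_element[OF C(1) that, of "\<lambda>c. g (l c)"]
    by (simp add: ip_distribs)
  have "ip (?X - ?Y) ?X = 0" "ip (?X - ?Y) ?Y = 0"
    unfolding ip_sum_right[of _ _ C] ip_sum_right[of _ _ D]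
    using C0 D0 by (auto simp: ip_distribs(6) intro!: sum.neutral)
  then have "ip (?X - ?Y) (?X - ?Y) = 0" by (simp add: ip_distribs(4))
  then show ?thesis by (simp add: ip_eq_0_iff)
qed

text \<open>
  For \<open>g = sqrt\<close> this is the square root, for \<open>g = inverse\<close> the inverse of an invertible element,
  and on positive elements the trace for \<open>g = ln\<close> is the logarithm of the determinant.
\<close>

definition fcalc :: "(real \<Rightarrow> real) \<Rightarrow> 'a \<Rightarrow> 'a" where
  "fcalc g x = (THE y. \<exists>C l. spectral_decomposition J e x C l \<and> y = (\<Sum>c\<in>C. g (l c) *\<^sub>R c))"

lemma fcalc_eq:
  assumes "spectral_decomposition J e x C l"
  shows "fcalc g x = (\<Sum>c\<in>C. g (l c) *\<^sub>R c)"
  unfolding fcalc_def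
  by (rule the_equality) (use assms functional_calculus_unique in blast)+

lemma sqrt_eq_fcalc: "jordan_sqrt J e = fcalc sqrt"
  by (simp add: fun_eq_iff jordan_sqrt_def fcalc_def)

lemma fcalc_spectral:
  assumes "spectral_decomposition J e x C l"
  shows "spectral_decomposition J e (fcalc g x) C (\<lambda>c. g (l c))"
  using assms fcalc_eq[OF assms] by (simp add: spectral_decomposition_def)

definition positive :: "'a \<Rightarrow> bool" where
  "positive x \<longleftrightarrow> (\<exists>C l. spectral_decomposition J e x C l \<and> (\<forall>c\<in>C. l c > 0))"

lemma positive_eigenvalues:
  assumes "positive x" and D: "spectral_decomposition J e x D m" "d \<in> D"
  shows "m d > 0"
proof (rule ccontr)
  assume neg: "\<not> m d > 0"
  obtain C l where C: "spectral_decomposition J e x C l" "\<forall>c\<in>C. l c > 0"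
    using assms(1) by (auto simp: positive_def)
  have "ip d c = 0" if "c \<in> C" for c
    using eigenvalues_match[OF C(1) D(1) that D(2), of "\<lambda>t. t"] C(2) that neg
    by (auto simp: ip_sym[of d c])
  then show False
    using ip_frame_row[OF spectral_decompositionD(1)[OF C(1)] spectral_decompositionD(5)[OF D]] by simp
qed

lemma positive_spectral:
  assumes "positive x"
  obtains C l where "spectral_decomposition J e x C l" "\<And>c. c \<in> C \<Longrightarrow> l c > 0"
  using assms by (auto simp: positive_def)

text \<open>
  The product of the eigenvalues is the exponential of the trace of the logarithm, so it inherits
  its independence of the decomposition from functional calculus.
\<close>

lemma det_positive:
  assumes "positive x"
  shows "jordan_det J e x = exp (tr (fcalc ln x))"
proof -
  have *: "(\<Prod>c\<in>C. l c) = exp (tr (fcalc ln x))" if "spectral_decomposition J e x C l" for C l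
  proof -
    have "exp (tr (fcalc ln x)) = exp (\<Sum>c\<in>C. ln (l c))"
      using tr_spectral[OF fcalc_spectral[OF that, of ln]] by simp
    also have "\<dots> = (\<Prod>c\<in>C. l c)"
      using spectral_decompositionD(2)[OF that] positive_eigenvalues[OF assms that]
      by (simp add: exp_sum)
    finally show ?thesis by simp
  qed
  then show ?thesis
    unfolding jordan_det_def using spectral_decomposition_exists[of x]
    by (intro the_equality) (metis, metis)
qed

abbreviation lndet :: "'a \<Rightarrow> real" where "lndet x \<equiv> ln (jordan_det J e x)"

lemma lndet_spectral:
  assumes "positive x" "spectral_decomposition J e x C l"
  shows "lndet x = (\<Sum>c\<in>C. ln (l c))"
  using tr_spectral[OF fcalc_spectral[OF assms(2), of ln]] by (simp add: det_positive[OF assms(1)])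

lemma positive_scale:
  assumes "positive x" "k > 0"
  shows "positive (k *\<^sub>R x)" "lndet (k *\<^sub>R x) = lndet x + jordan_rank J e * ln k"
proof -
  obtain C l where C: "spectral_decomposition J e x C l" "\<And>c. c \<in> C \<Longrightarrow> l c > 0"
    using positive_spectral[OF assms(1)] by blast
  have S: "spectral_decomposition J e (k *\<^sub>R x) C (\<lambda>c. k * l c)"
    using C(1) by (simp add: spectral_decomposition_def scaleR_sum_right)
  then show pos: "positive (k *\<^sub>R x)"
    using C(2) assms(2) by (auto simp: positive_def intro!: exI[of _ C] exI[of _ "\<lambda>c. k * l c"])
  have "lndet (k *\<^sub>R x) = (\<Sum>c\<in>C. ln k + ln (l c))"
    unfolding lndet_spectral[OF pos S] using C(2) assms(2) by (intro sum.cong) (auto simp: ln_mult_pos)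
  also have "\<dots> = lndet x + card C * ln k"
    by (simp add: sum.distrib lndet_spectral[OF assms(1) C(1)])
  finally show "lndet (k *\<^sub>R x) = lndet x + jordan_rank J e * ln k"
    using card_frame[OF spectral_decompositionD(1)[OF C(1)]] by (simp add: rank_eq_tr)
qed

text \<open>
  Moving \<open>w\<close> a little in the direction \<open>- e\<close> stays in the cone, and a square has nonnegative
  trace form with every primitive idempotent.
\<close>

lemma interior_cone_positive:
  assumes "w \<in> interior (cone_of_squares J)"
  shows "positive w"
proof -
  obtain C l where C: "spectral_decomposition J e w C l"
    using spectral_decomposition_exists by blast
  note Cd = spectral_decompositionD[OF C]
  have "((\<lambda>t::real. w - t *\<^sub>R e) \<longlongrightarrow> w - 0 *\<^sub>R e) (at_right 0)"
    by (intro tendsto_intros)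
  then have "eventually (\<lambda>t. w - t *\<^sub>R e \<in> interior (cone_of_squares J)) (at_right 0)"
    using assms by (intro topological_tendstoD) auto
  moreover have "eventually (\<lambda>t::real. t > 0) (at_right 0)"
    by (simp add: eventually_at_right_less)
  ultimately obtain t where t: "t > 0" "w - t *\<^sub>R e \<in> interior (cone_of_squares J)"
    using eventually_happens[OF eventually_conj] trivial_limit_at_right_real by blast
  then obtain y where y: "w - t *\<^sub>R e = y \<odot> y"
    using interior_subset by (auto simp: cone_of_squares_def)
  obtain D m where D: "spectral_decomposition J e y D m"
    using spectral_decomposition_exists by blast
  note Dd = spectral_decompositionD[OF D]
  have yy: "y \<odot> y = (\<Sum>d\<in>D. (m d * m d) *\<^sub>R d)"
    using frame_mult[OF Dd(1), of m m] Dd(4) by simp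
  have "l c > 0" if c: "c \<in> C" for c
  proof -
    have "0 \<le> (\<Sum>d\<in>D. (m d * m d) * ip d c)"
      by (intro sum_nonneg mult_nonneg_nonneg[OF zero_le_square] ip_primitives_nonneg Cd(5) Dd(5) c)
    also have "\<dots> = ip (y \<odot> y) c" by (simp add: yy ip_sum_left ip_distribs)
    also have "\<dots> = l c - t"
      using ip_frame_element[OF Cd(1) c, of l] Cd(5)[OF c]
      by (simp flip: y Cd(4) add: ip_distribs tr_primitive)
    finally show ?thesis using t by simp
  qed
  with C show ?thesis by (auto simp: positive_def)
qed

section \<open>The quadratic representation on a frame\<close>

abbreviation P :: "'a \<Rightarrow> 'a \<Rightarrow> 'a" where "P \<equiv> quad_rep J"

lemma ip_P: "ip (P x a) b = ip a (P x b)"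
  by (simp add: quad_rep_def ip_distribs ip_assoc)

lemma tr_P: "tr (P x a) = ip (x \<odot> x) a"
  using ip_assoc[of x x a] by (simp add: quad_rep_def jordan_inner_def tr_diff tr_scaleR)

lemma P_distribs: "P x (a + b) = P x a + P x b" "P x (a - b) = P x a - P x b"
  "P x (k *\<^sub>R a) = k *\<^sub>R P x a" "P x (- a) = - P x a"
  by (simp_all add: quad_rep_def J_distribs algebra_simps)

lemma linear_P: "linear (P x)"
  by (rule linearI) (simp_all add: P_distribs)

lemma P_e [simp]: "P e y = y"
  by (simp add: quad_rep_def scaleR_2)

text \<open>
  The linearised identity says that the commutator of the multiplications by \<open>d\<close> and \<open>c c\<close> is a
  multiple of that for \<open>c\<close> and \<open>c d\<close>, which is zero here.
\<close>

lemma orthogonal_idempotents_commute: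
  assumes "c \<odot> c = c" "c \<odot> d = 0"
  shows "c \<odot> (d \<odot> y) = d \<odot> (c \<odot> y)"
  using jordan_linearised[of d c y] assms by simp

lemma frame_commute:
  assumes "jordan_frame J e C" "c \<in> C" "d \<in> C"
  shows "c \<odot> (d \<odot> y) = d \<odot> (c \<odot> y)"
  using assms orthogonal_idempotents_commute[of c d y]
  by (cases "c = d") (auto simp: jordan_frame_def primitive_idempotent_def)

lemma frame_combinations_commute:
  assumes "jordan_frame J e C"
  shows "(\<Sum>c\<in>C. l c *\<^sub>R c) \<odot> ((\<Sum>c\<in>C. m c *\<^sub>R c) \<odot> y) =
    (\<Sum>c\<in>C. m c *\<^sub>R c) \<odot> ((\<Sum>c\<in>C. l c *\<^sub>R c) \<odot> y)"
proof -
  have "(\<Sum>c\<in>C. l c *\<^sub>R c) \<odot> ((\<Sum>c\<in>C. m c *\<^sub>R c) \<odot> y) =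
      (\<Sum>d\<in>C. \<Sum>c\<in>C. (l c * m d) *\<^sub>R (c \<odot> (d \<odot> y)))"
    by (simp add: J_sum_left J_sum_right J_distribs scaleR_sum_right mult.commute)
  also have "\<dots> = (\<Sum>d\<in>C. \<Sum>c\<in>C. (m d * l c) *\<^sub>R (d \<odot> (c \<odot> y)))"
    by (intro sum.cong refl) (simp add: frame_commute[OF assms] mult.commute)
  also have "\<dots> = (\<Sum>c\<in>C. m c *\<^sub>R c) \<odot> ((\<Sum>c\<in>C. l c *\<^sub>R c) \<odot> y)"
    by (subst sum.swap) (simp add: J_sum_left J_sum_right J_distribs scaleR_sum_right mult.commute)
  finally show ?thesis .
qed

text \<open>
  Commuting diagonalisable operators have a joint eigenbasis. In the induction step a joint
  eigenvector of \<open>C\<close> is split into its components for the eigenvalues 1, 1/2 and 0 of \<open>c\<close>, which are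
  \<open>2 L\<^sup>2 - L\<close>, \<open>4 L - 4 L\<^sup>2\<close> and \<open>1 - 3 L + 2 L\<^sup>2\<close> with \<open>L\<close> the multiplication by \<open>c\<close>.
\<close>

lemma span_joint_eigenvectors:
  assumes "finite C" "\<And>c. c \<in> C \<Longrightarrow> c \<odot> c = c"
    and "\<And>c d y. c \<in> C \<Longrightarrow> d \<in> C \<Longrightarrow> c \<odot> (d \<odot> y) = d \<odot> (c \<odot> y)"
  shows "span {y. \<forall>c\<in>C. \<exists>k\<in>{0, 1/2, 1}. c \<odot> y = k *\<^sub>R y} = UNIV"
  using assms
proof (induction C)
  case empty
  then show ?case by simp
next
  case (insert c C)
  let ?E = "\<lambda>C. {y. \<forall>c\<in>C. \<exists>k\<in>{0, 1/2, 1}. c \<odot> y = k *\<^sub>R y}"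
  have "?E C \<subseteq> span (?E (insert c C))"
  proof
    fix y assume y: "y \<in> ?E C"
    define z w where "z = c \<odot> y" and "w = c \<odot> z"
    have cw: "c \<odot> w = (3/2) *\<^sub>R w - (1/2) *\<^sub>R z"
    proof -
      have "(1/2) *\<^sub>R (2 *\<^sub>R (c \<odot> w)) = (1/2) *\<^sub>R (3 *\<^sub>R w - z)"
        using idempotent_cubic[of c y] insert.prems(1) by (simp add: z_def w_def)
      then show ?thesis by (simp add: scaleR_diff_right)
    qed
    have w3: "3 *\<^sub>R w = w + 2 *\<^sub>R w" "6 *\<^sub>R w = 2 *\<^sub>R w + 4 *\<^sub>R w"
      using scaleR_add_left[of 1 2 w] scaleR_add_left[of 2 4 w] by simp_all
    have inE: "a *\<^sub>R y + b *\<^sub>R z + g *\<^sub>R w \<in> ?E (insert c C)"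
      if "c \<odot> (a *\<^sub>R y + b *\<^sub>R z + g *\<^sub>R w) = k *\<^sub>R (a *\<^sub>R y + b *\<^sub>R z + g *\<^sub>R w)"
        "k \<in> {0, 1/2, 1}" for a b g k
    proof -
      have "\<exists>k\<in>{0, 1/2, 1}. d \<odot> (a *\<^sub>R y + b *\<^sub>R z + g *\<^sub>R w) = k *\<^sub>R (a *\<^sub>R y + b *\<^sub>R z + g *\<^sub>R w)"
        if d: "d \<in> C" for d
      proof -
        obtain k where k: "k \<in> {0, 1/2, 1}" "d \<odot> y = k *\<^sub>R y" using y d by blast
        have dz: "d \<odot> z = k *\<^sub>R z"
          unfolding z_def using insert.prems(2)[of d c y] d k by (simp add: J_distribs)
        have "d \<odot> w = k *\<^sub>R w"
          unfolding w_def using insert.prems(2)[of d c z] d dz by (simp add: J_distribs)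
        then show ?thesis using k dz
          by (intro bexI[of _ k]) (auto simp: J_distribs scaleR_add_right mult.commute)
      qed
      with that show ?thesis by blast
    qed
    have "(0 *\<^sub>R y + (-1) *\<^sub>R z + 2 *\<^sub>R w) \<in> ?E (insert c C)"
      by (rule inE[of _ _ _ 1]) (simp_all add: J_distribs cw scaleR_diff_right flip: w_def z_def, simp add: w3 algebra_simps)
    moreover have "(0 *\<^sub>R y + 4 *\<^sub>R z + (-4) *\<^sub>R w) \<in> ?E (insert c C)"
      by (rule inE[of _ _ _ "1/2"]) (simp_all add: J_distribs cw scaleR_diff_right flip: w_def z_def, simp add: w3 algebra_simps)
    moreover have "(1 *\<^sub>R y + (-3) *\<^sub>R z + 2 *\<^sub>R w) \<in> ?E (insert c C)"
      by (rule inE[of _ _ _ 0]) (simp_all add: J_distribs cw scaleR_diff_right flip: w_def z_def)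
    ultimately have "(0 *\<^sub>R y + (-1) *\<^sub>R z + 2 *\<^sub>R w) + (0 *\<^sub>R y + 4 *\<^sub>R z + (-4) *\<^sub>R w)
        + (1 *\<^sub>R y + (-3) *\<^sub>R z + 2 *\<^sub>R w) \<in> span (?E (insert c C))"
      by (intro span_add span_base)
    also have "(0 *\<^sub>R y + (-1) *\<^sub>R z + 2 *\<^sub>R w) + (0 *\<^sub>R y + 4 *\<^sub>R z + (-4) *\<^sub>R w)
        + (1 *\<^sub>R y + (-3) *\<^sub>R z + 2 *\<^sub>R w) = y + (-1 + 4 + -3) *\<^sub>R z + (2 + -4 + 2) *\<^sub>R w"
      unfolding scaleR_add_left by (simp add: algebra_simps)
    also have "\<dots> = y" by simp
    finally show "y \<in> span (?E (insert c C))" .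
  qed
  then have "span (?E C) \<subseteq> span (?E (insert c C))"
    by (rule span_minimal) (rule subspace_span)
  then show ?case using insert.IH insert.prems by auto
qed

text \<open>
  On the subalgebra spanned by a frame the quadratic representation is multiplicative, since it acts
  on joint eigenvectors by \<open>l i * l j\<close>.
\<close>

lemma P_frame_mult:
  assumes C: "jordan_frame J e C"
  shows "P (\<Sum>c\<in>C. l c *\<^sub>R c) (P (\<Sum>c\<in>C. m c *\<^sub>R c) y) = P (\<Sum>c\<in>C. (l c * m c) *\<^sub>R c) y"
proof -
  have fin: "finite C" and se: "(\<Sum>c\<in>C. c) = e" and idem: "\<And>c. c \<in> C \<Longrightarrow> c \<odot> c = c"
    using C by (auto simp: jordan_frame_def primitive_idempotent_def)
  let ?E = "{y. \<forall>c\<in>C. \<exists>k\<in>{0, 1/2, 1}. c \<odot> y = k *\<^sub>R y}"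
  have on_E: "P (\<Sum>c\<in>C. l c *\<^sub>R c) (P (\<Sum>c\<in>C. m c *\<^sub>R c) y) = P (\<Sum>c\<in>C. (l c * m c) *\<^sub>R c) y"
    if "y \<in> ?E" for y
  proof (cases "y = 0")
    case False
    have "\<forall>c\<in>C. \<exists>k. k \<in> {0, 1/2, 1} \<and> c \<odot> y = k *\<^sub>R y" using that by blast
    then obtain k where k: "\<And>c. c \<in> C \<Longrightarrow> k c \<in> {0, 1/2, 1}" "\<And>c. c \<in> C \<Longrightarrow> c \<odot> y = k c *\<^sub>R y"
      by metis
    have act: "(\<Sum>c\<in>C. l c *\<^sub>R c) \<odot> y = (\<Sum>c\<in>C. l c * k c) *\<^sub>R y" for l
      unfolding J_sum_left scaleR_sum_left by (rule sum.cong) (auto simp: J_distribs k)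
    have "1 *\<^sub>R y = (\<Sum>c\<in>C. k c) *\<^sub>R y" using act[of "\<lambda>_. 1"] se by simp
    then have "(\<Sum>c\<in>C. k c) = 1" using False by (metis scaleR_cancel_right)
    then obtain i j where ij: "\<And>l. 2 * (\<Sum>c\<in>C. l c * k c)\<^sup>2 - (\<Sum>c\<in>C. (l c)\<^sup>2 * k c) = l i * l j"
      using half_weights[of C k] fin k(1) by blast
    have "P (\<Sum>c\<in>C. l c *\<^sub>R c) y = (l i * l j) *\<^sub>R y" for l
      unfolding quad_rep_def frame_mult[OF C] act J_distribs ij[symmetric]
      by (simp add: scaleR_diff_left power2_eq_square)
    then show ?thesis by (simp add: P_distribs algebra_simps)
  qed (simp add: linear_0[OF linear_P])
  have "y \<in> span ?E"
    using span_joint_eigenvectors[OF fin idem frame_commute[OF C]] by blast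
  then show ?thesis
    by (rule linear_eq_on_span[of "\<lambda>y. P _ (P _ y)" "P _", rotated -1])
       (use on_E in \<open>auto intro!: linearI simp: P_distribs\<close>)
qed

abbreviation jordan_inverse :: "'a \<Rightarrow> 'a" where "jordan_inverse \<equiv> fcalc inverse"

lemma
  assumes "positive x"
  shows inverse_mult: "x \<odot> jordan_inverse x = e"
    and P_inverse_P: "P (jordan_inverse x) (P x y) = y"
    and inverse_commute: "x \<odot> (jordan_inverse x \<odot> y) = jordan_inverse x \<odot> (x \<odot> y)"
    and P_inverse: "P x (jordan_inverse x) = x"
    and sqrt_mult_sqrt: "jordan_sqrt J e x \<odot> jordan_sqrt J e x = x"
    and P_sqrt_P_sqrt: "P (jordan_sqrt J e x) (P (jordan_sqrt J e x) y) = P x y"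
proof -
  obtain C l where C: "spectral_decomposition J e x C l" "\<And>c. c \<in> C \<Longrightarrow> l c > 0"
    using positive_spectral[OF assms] by blast
  note Cd = spectral_decompositionD[OF C(1)]
  note m = frame_mult[OF Cd(1)] and q = P_frame_mult[OF Cd(1)]
  have i: "jordan_inverse x = (\<Sum>c\<in>C. inverse (l c) *\<^sub>R c)" by (rule fcalc_eq[OF C(1)])
  have s: "jordan_sqrt J e x = (\<Sum>c\<in>C. sqrt (l c) *\<^sub>R c)"
    unfolding sqrt_eq_fcalc by (rule fcalc_eq[OF C(1)])
  have ne: "l c \<noteq> 0" if "c \<in> C" for c using C(2)[OF that] by simp
  have one: "(\<Sum>c\<in>C. (l c * inverse (l c)) *\<^sub>R c) = e"
    "(\<Sum>c\<in>C. (inverse (l c) * l c) *\<^sub>R c) = e"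
    using Cd(3) ne by (auto simp: cong: sum.cong)
  have sq: "(\<Sum>c\<in>C. (sqrt (l c) * sqrt (l c)) *\<^sub>R c) = x"
    unfolding Cd(4) by (rule sum.cong) (use C(2) in \<open>auto simp: less_imp_le\<close>)
  have sq2: "(\<Sum>c\<in>C. (l c * l c * inverse (l c)) *\<^sub>R c) = x"
    unfolding Cd(4) by (rule sum.cong) (use ne in auto)
  show 1: "x \<odot> jordan_inverse x = e" unfolding i unfolding Cd(4) m one ..
  have 2: "(x \<odot> x) \<odot> jordan_inverse x = x" using sq2 unfolding i unfolding Cd(4) m .
  show "P (jordan_inverse x) (P x y) = y" unfolding i unfolding Cd(4) q one by simp
  show "x \<odot> (jordan_inverse x \<odot> y) = jordan_inverse x \<odot> (x \<odot> y)"
    unfolding i unfolding Cd(4) by (rule frame_combinations_commute[OF Cd(1)])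
  show "P x (jordan_inverse x) = x" by (simp add: quad_rep_def 1 2 scaleR_2)
  show "jordan_sqrt J e x \<odot> jordan_sqrt J e x = x" unfolding s m by (rule sq)
  show "P (jordan_sqrt J e x) (P (jordan_sqrt J e x) y) = P x y" unfolding s q sq ..
qed

section \<open>Derivatives of the inverse and of the logarithmic determinant\<close>

text \<open>
  If \<open>a\<close> is diagonalised by a frame, its trace form with \<open>d\<close> is a convex combination of eigenvalues.
\<close>

lemma ip_primitive_bound: "\<exists>K\<ge>0. \<forall>d. primitive_idempotent J d \<longrightarrow> \<bar>ip a d\<bar> \<le> K"
proof -
  obtain C l where dec: "spectral_decomposition J e a C l"
    using spectral_decomposition_exists by blast
  note C = spectral_decompositionD[OF dec]
  have "\<bar>ip a d\<bar> \<le> (\<Sum>c\<in>C. \<bar>l c\<bar>)" if d: "primitive_idempotent J d" for d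
  proof -
    have "ip c d \<le> 1" if "c \<in> C" for c
      using member_le_sum[of c C "\<lambda>c. ip d c"] ip_frame_row[OF C(1) d] C(2) ip_primitives_nonneg[OF d C(5)] that
      by (simp add: ip_sym[of d])
    then have le: "\<bar>l c * ip c d\<bar> \<le> \<bar>l c\<bar>" if "c \<in> C" for c
      using ip_primitives_nonneg[OF C(5) d] that
      by (auto simp: abs_mult intro!: mult_left_le)
    have "ip a d = (\<Sum>c\<in>C. l c * ip c d)"
      by (subst C(4)) (simp add: ip_sum_left ip_distribs)
    also have "\<bar>\<dots>\<bar> \<le> (\<Sum>c\<in>C. \<bar>l c\<bar>)"
      by (rule order.trans[OF sum_abs]) (intro sum_mono le)
    finally show ?thesis .
  qed
  then show ?thesis by (intro exI[of _ "\<Sum>c\<in>C. \<bar>l c\<bar>"]) (auto intro: sum_nonneg)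
qed

text \<open>
  An eigenvalue of \<open>x + t a\<close> is its trace form with a primitive idempotent, which is at least the
  smallest eigenvalue of \<open>x\<close> minus a multiple of \<open>|t|\<close>.
\<close>

lemma eigenvalues_bounded_below_on_line:
  assumes "positive x"
  shows "\<exists>m>0. \<exists>\<delta>>0. \<forall>t. \<bar>t\<bar> < \<delta> \<longrightarrow>
    (\<forall>D l. spectral_decomposition J e (x + t *\<^sub>R a) D l \<longrightarrow> (\<forall>d\<in>D. l d \<ge> m))"
proof -
  obtain C l where C: "spectral_decomposition J e x C l" "\<And>c. c \<in> C \<Longrightarrow> l c > 0"
    using positive_spectral[OF assms] by blast
  note Cd = spectral_decompositionD[OF C(1)]
  \<comment> \<open>The element 1 keeps the minimum defined in the algebra of dimension zero, where \<open>C\<close> is empty.\<close>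
  define m where "m = Min (insert 1 (l ` C))"
  have m: "m > 0" using C(2) Cd(2) by (simp add: m_def)
  have m_le: "m \<le> l c" if "c \<in> C" for c using that Cd(2) by (simp add: m_def)
  obtain K where K: "K \<ge> 0" "\<And>d. primitive_idempotent J d \<Longrightarrow> \<bar>ip a d\<bar> \<le> K"
    using ip_primitive_bound[of a] by blast
  \<comment> \<open>Chosen such that the perturbation costs at most half of the smallest eigenvalue.\<close>
  define \<delta> where "\<delta> = m / (2 * (K + 1))"
  have "\<delta> > 0" using m K by (simp add: \<delta>_def)
  have "l' d \<ge> m / 2" if t: "\<bar>t\<bar> < \<delta>" and D: "spectral_decomposition J e (x + t *\<^sub>R a) D l'" "d \<in> D" for t D l' d
  proof -
    note Dd = spectral_decompositionD[OF D(1)]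
    note d = Dd(5)[OF D(2)]
    have "m = (\<Sum>c\<in>C. m * ip c d)"
      using ip_frame_row[OF Cd(1) d] by (simp add: ip_sym flip: sum_distrib_left)
    also have "\<dots> \<le> (\<Sum>c\<in>C. l c * ip c d)"
      by (intro sum_mono mult_right_mono m_le ip_primitives_nonneg Cd(5) d)
    also have "\<dots> = ip x d"
      by (subst Cd(4)) (simp add: ip_sum_left ip_distribs)
    finally have "m \<le> ip x d" .
    moreover have "\<bar>t * ip a d\<bar> \<le> \<delta> * (K + 1)"
      unfolding abs_mult using t K(1) K(2)[OF d] \<open>\<delta> > 0\<close> by (intro mult_mono) auto
    moreover have "\<delta> * (K + 1) = m / 2" using K(1) by (simp add: \<delta>_def field_simps)
    moreover have "l' d = ip x d + t * ip a d"
      using ip_frame_element[OF Dd(1) D(2), of l'] by (simp flip: Dd(4) add: ip_distribs)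
    ultimately show ?thesis by linarith
  qed
  then show ?thesis using m \<open>\<delta> > 0\<close> by (intro exI[of _ "m / 2"] conjI exI[of _ \<delta>]) auto
qed

lemma inverse_bounded_on_line:
  assumes "positive x"
  obtains \<delta> where "\<delta> > 0" "\<And>t. \<bar>t\<bar> < \<delta> \<Longrightarrow> positive (x + t *\<^sub>R a)"
    "\<And>z. \<exists>B. \<forall>t. \<bar>t\<bar> < \<delta> \<longrightarrow> \<bar>ip z (jordan_inverse (x + t *\<^sub>R a))\<bar> \<le> B"
proof -
  obtain m \<delta> where m: "m > 0" and \<delta>: "\<delta> > 0"
    and ev: "\<And>t D l d. \<bar>t\<bar> < \<delta> \<Longrightarrow> spectral_decomposition J e (x + t *\<^sub>R a) D l \<Longrightarrow> d \<in> D \<Longrightarrow> l d \<ge> m"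
    using eigenvalues_bounded_below_on_line[OF assms, of a] by blast
  have pos: "positive (x + t *\<^sub>R a)" if "\<bar>t\<bar> < \<delta>" for t
    using spectral_decomposition_exists[of "x + t *\<^sub>R a"] ev[OF that] m
    unfolding positive_def by (meson less_le_trans)
  have "\<exists>B. \<forall>t. \<bar>t\<bar> < \<delta> \<longrightarrow> \<bar>ip z (jordan_inverse (x + t *\<^sub>R a))\<bar> \<le> B" for z
  proof -
    obtain K where K: "K \<ge> 0" "\<And>d. primitive_idempotent J d \<Longrightarrow> \<bar>ip z d\<bar> \<le> K"
      using ip_primitive_bound[of z] by blast
    have "\<bar>ip z (jordan_inverse (x + t *\<^sub>R a))\<bar> \<le> tr e * (inverse m * K)" if t: "\<bar>t\<bar> < \<delta>" for t
    proof -
      obtain D l where D: "spectral_decomposition J e (x + t *\<^sub>R a) D l"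
        using spectral_decomposition_exists by blast
      note Dd = spectral_decompositionD[OF D]
      have le: "\<bar>inverse (l d) * ip z d\<bar> \<le> inverse m * K" if "d \<in> D" for d
        unfolding abs_mult using m ev[OF t D that] K(2)[OF Dd(5)[OF that]]
        by (intro mult_mono) (auto simp: le_imp_inverse_le)
      have "\<bar>ip z (jordan_inverse (x + t *\<^sub>R a))\<bar> = \<bar>\<Sum>d\<in>D. inverse (l d) * ip z d\<bar>"
        by (simp add: fcalc_eq[OF D] ip_sum_right ip_distribs)
      also have "\<dots> \<le> (\<Sum>d\<in>D. inverse m * K)"
        by (rule order.trans[OF sum_abs]) (intro sum_mono le)
      also have "\<dots> = tr e * (inverse m * K)" by (simp add: card_frame[OF Dd(1)])
      finally show ?thesis .
    qed
    then show ?thesis by blast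
  qed
  with \<delta> pos show thesis using that by blast
qed

text \<open>
  The symmetric bilinear map that polarises the quadratic map \<open>x \<mapsto> P x\<close>.
\<close>

definition P_polar :: "'a \<Rightarrow> 'a \<Rightarrow> 'a \<Rightarrow> 'a" where
  "P_polar x a y = x \<odot> (a \<odot> y) + a \<odot> (x \<odot> y) - (x \<odot> a) \<odot> y"

lemma ip_P_polar: "ip (P_polar x a u) y = ip u (P_polar x a y)"
  by (simp add: P_polar_def ip_distribs ip_assoc)

lemma P_line: "P (x + t *\<^sub>R a) y = P x y + (2 * t) *\<^sub>R P_polar x a y + t\<^sup>2 *\<^sub>R P a y"
  by (simp add: quad_rep_def P_polar_def J_distribs commute[of a x] algebra_simps power2_eq_square)
     (simp flip: scaleR_add_left add: mult.commute)

lemma P_polar_inverse: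
  assumes "positive x"
  shows "P_polar x a (jordan_inverse x) = a"
  using inverse_mult[OF assms] inverse_commute[OF assms] 
  by (simp add: P_polar_def commute[of a "jordan_inverse x"] commute[of _ "jordan_inverse x"])

text \<open>
  Expand \<open>P (x + t a) y = x + t a\<close> in \<open>t\<close>, subtract \<open>P x x\<^sup>-\<^sup>1 = x\<close>, and apply
  \<open>P x\<^sup>-\<^sup>1\<close>, which inverts \<open>P x\<close>.
\<close>

lemma inverse_difference:
  assumes "positive x" "positive (x + t *\<^sub>R a)"
  defines "y \<equiv> jordan_inverse (x + t *\<^sub>R a)"
  shows "y - jordan_inverse x = t *\<^sub>R P (jordan_inverse x) (a - 2 *\<^sub>R P_polar x a y - t *\<^sub>R P a y)"
proof -
  have "P (x + t *\<^sub>R a) y = x + t *\<^sub>R a"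
    unfolding y_def by (rule P_inverse[OF assms(2)])
  then have "P x (y - jordan_inverse x) = t *\<^sub>R (a - 2 *\<^sub>R P_polar x a y - t *\<^sub>R P a y)"
    unfolding P_line P_distribs P_inverse[OF assms(1)]
    by (simp add: algebra_simps power2_eq_square)
  then have "P (jordan_inverse x) (P x (y - jordan_inverse x)) = P (jordan_inverse x) (t *\<^sub>R (a - 2 *\<^sub>R P_polar x a y - t *\<^sub>R P a y))"
    by simp
  then show ?thesis
    unfolding P_inverse_P[OF assms(1)] P_distribs(3) .
qed

text \<open>
  The exact difference formula shows first that the inverse is continuous along the line, because
  inverses stay bounded there, and then what the limit of the difference quotient is: at \<open>t = 0\<close> the
  polar term equals \<open>a\<close>, so \<open>a - 2 a = - a\<close> remains.
\<close>

lemma inverse_derivative: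
  assumes "positive x"
  shows "((\<lambda>t. ip (jordan_inverse (x + t *\<^sub>R a)) b) has_real_derivative - ip (P (jordan_inverse x) a) b) (at 0)"
proof -
  define h where "h = (\<lambda>z t. ip z (jordan_inverse (x + t *\<^sub>R a)))"
  obtain \<delta> where \<delta>: "\<delta> > 0" and pos: "\<And>t. \<bar>t\<bar> < \<delta> \<Longrightarrow> positive (x + t *\<^sub>R a)"
    and bdd: "\<And>z. \<exists>B. \<forall>t. \<bar>t\<bar> < \<delta> \<longrightarrow> \<bar>h z t\<bar> \<le> B"
    using inverse_bounded_on_line[OF assms, of a] unfolding h_def by blast
  have near: "eventually (\<lambda>t. \<bar>t\<bar> < \<delta> \<and> t \<noteq> 0) (at (0::real))"
    using \<delta> by (auto simp: eventually_at intro!: exI[of _ \<delta>])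
  have diff: "h z t - h z 0 =
      t * (ip (P (jordan_inverse x) z) a - 2 * h (P_polar x a (P (jordan_inverse x) z)) t - t * h (P a (P (jordan_inverse x) z)) t)"
    if "\<bar>t\<bar> < \<delta>" for z t
  proof -
    have "h z t - h z 0 = ip z (jordan_inverse (x + t *\<^sub>R a) - jordan_inverse x)"
      by (simp add: h_def ip_distribs)
    then show ?thesis
      unfolding inverse_difference[OF assms pos[OF that]] h_def
      by (simp add: ip_distribs ip_P_polar flip: ip_P)
  qed
  have cont: "(h z \<longlongrightarrow> h z 0) (at 0)" for z
  proof -
    obtain B1 where B1: "\<And>t. \<bar>t\<bar> < \<delta> \<Longrightarrow> \<bar>h (P_polar x a (P (jordan_inverse x) z)) t\<bar> \<le> B1" using bdd by blast
    obtain B2 where B2: "\<And>t. \<bar>t\<bar> < \<delta> \<Longrightarrow> \<bar>h (P a (P (jordan_inverse x) z)) t\<bar> \<le> B2" using bdd by blast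
    define M where "M = \<bar>ip (P (jordan_inverse x) z) a\<bar> + 2 * B1 + \<delta> * B2"
    have "norm (h z t - h z 0) \<le> \<bar>t\<bar> * M" if "\<bar>t\<bar> < \<delta> \<and> t \<noteq> 0" for t
    proof -
      have "\<bar>t * h (P a (P (jordan_inverse x) z)) t\<bar> \<le> \<delta> * B2"
        unfolding abs_mult using B2[of t] that \<delta> by (intro mult_mono) auto
      then have "\<bar>ip (P (jordan_inverse x) z) a - 2 * h (P_polar x a (P (jordan_inverse x) z)) t - t * h (P a (P (jordan_inverse x) z)) t\<bar> \<le> M"
        using B1[of t] that unfolding M_def by linarith
      then show ?thesis
        using that by (simp add: diff abs_mult mult_left_mono)
    qed
    then have "eventually (\<lambda>t. norm (h z t - h z 0) \<le> \<bar>t\<bar> * M) (at 0)"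
      using near by (rule eventually_mono[rotated])
    moreover have "((\<lambda>t. \<bar>t\<bar> * M) \<longlongrightarrow> 0) (at 0)"
      by (auto intro!: tendsto_eq_intros)
    ultimately have "((\<lambda>t. h z t - h z 0) \<longlongrightarrow> 0) (at 0)"
      by (rule Lim_null_comparison)
    then show ?thesis by (simp add: LIM_zero_iff)
  qed
  let ?c = "P (jordan_inverse x) b"
  have "((\<lambda>t. ip ?c a - 2 * h (P_polar x a ?c) t - t * h (P a ?c) t) \<longlongrightarrow>
      ip ?c a - 2 * h (P_polar x a ?c) 0 - 0 * h (P a ?c) 0) (at 0)"
    by (intro tendsto_intros cont)
  moreover have "h (P_polar x a ?c) 0 = ip ?c a"
    by (simp add: h_def ip_P_polar P_polar_inverse[OF assms])
  moreover have "ip ?c a = ip (P (jordan_inverse x) a) b"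
    by (simp add: ip_P ip_sym[of _ b])
  ultimately have lim: "((\<lambda>t. ip ?c a - 2 * h (P_polar x a ?c) t - t * h (P a ?c) t) \<longlongrightarrow> - ip (P (jordan_inverse x) a) b) (at 0)"
    by simp
  have "eventually (\<lambda>t. ip ?c a - 2 * h (P_polar x a ?c) t - t * h (P a ?c) t = (h b t - h b 0) / t) (at 0)"
    using near by (rule eventually_mono) (simp add: diff)
  then have "((\<lambda>t. (h b t - h b 0) / t) \<longlongrightarrow> - ip (P (jordan_inverse x) a) b) (at 0)"
    using lim by (rule Lim_transform_eventually[rotated])
  then show ?thesis
    by (simp add: DERIV_def h_def ip_sym[of _ b])
qed

text \<open>
  Both sides are sums over pairs of members of two frames, weighted by the nonnegative trace forms of
  the pairs; termwise this is the concavity of \<open>ln\<close>.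
\<close>

lemma lndet_concave:
  assumes x: "positive x" and y: "positive y"
  shows "lndet y - lndet x \<le> ip (jordan_inverse x) (y - x)"
proof -
  obtain C l where C: "spectral_decomposition J e x C l" "\<And>c. c \<in> C \<Longrightarrow> l c > 0"
    using positive_spectral[OF x] by blast
  obtain D m where D: "spectral_decomposition J e y D m" "\<And>d. d \<in> D \<Longrightarrow> m d > 0"
    using positive_spectral[OF y] by blast
  note Cd = spectral_decompositionD[OF C(1)] and Dd = spectral_decompositionD[OF D(1)]
  have row: "(\<Sum>d\<in>D. ip c d) = 1" if "c \<in> C" for c
    by (rule ip_frame_row[OF Dd(1) Cd(5)[OF that]])
  have col: "(\<Sum>c\<in>C. ip c d) = 1" if "d \<in> D" for d
    using ip_frame_row[OF Cd(1) Dd(5)[OF that]] by (simp add: ip_sym)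
  have "lndet y = (\<Sum>d\<in>D. \<Sum>c\<in>C. ip c d * ln (m d))"
    unfolding lndet_spectral[OF y D(1)] by (rule sum.cong) (simp_all add: col flip: sum_distrib_right)
  moreover have "lndet x = (\<Sum>c\<in>C. \<Sum>d\<in>D. ip c d * ln (l c))"
    unfolding lndet_spectral[OF x C(1)] by (rule sum.cong) (simp_all add: row flip: sum_distrib_right)
  ultimately have "lndet y - lndet x = (\<Sum>c\<in>C. \<Sum>d\<in>D. ip c d * (ln (m d) - ln (l c)))"
    by (simp add: sum.swap[of _ D C] right_diff_distrib sum_subtractf)
  also have "\<dots> \<le> (\<Sum>c\<in>C. \<Sum>d\<in>D. ip c d * ((m d - l c) / l c))"
    by (intro sum_mono mult_left_mono ln_diff_le C(2) D(2) ip_primitives_nonneg Cd(5) Dd(5))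
  also have "\<dots> = (\<Sum>c\<in>C. \<Sum>d\<in>D. inverse (l c) * (m d * ip c d) - ip c d)"
    using C(2) by (intro sum.cong refl) (force simp: field_simps)
  also have "\<dots> = (\<Sum>c\<in>C. \<Sum>d\<in>D. inverse (l c) * (m d * ip c d)) - tr e"
    using row by (simp add: sum_subtractf card_frame[OF Cd(1)])
  also have "(\<Sum>c\<in>C. \<Sum>d\<in>D. inverse (l c) * (m d * ip c d)) = ip (jordan_inverse x) y"
    unfolding fcalc_eq[OF C(1)] by (subst Dd(4)) (simp add: ip_sum_left ip_sum_right ip_distribs sum_distrib_left sum.swap[of _ D C] mult.left_commute)
  also have "tr e = ip (jordan_inverse x) x"
    using inverse_mult[OF x] by (simp add: jordan_inner_def commute)
  finally show ?thesis by (simp add: ip_distribs)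
qed

lemma eventually_positive_on_line:
  assumes "positive x"
  shows "eventually (\<lambda>t. positive (x + t *\<^sub>R a)) (nhds 0)"
proof -
  obtain \<delta> where "\<delta> > 0" "\<And>t. \<bar>t\<bar> < \<delta> \<Longrightarrow> positive (x + t *\<^sub>R a)"
    using inverse_bounded_on_line[OF assms, of a] by metis
  then show ?thesis by (auto simp: eventually_nhds_metric dist_real_def)
qed

text \<open>
  Concavity, used at both ends of the segment, encloses the difference quotient between the values of
  the expected derivative at \<open>x\<close> and at \<open>x + t a\<close>, and the latter is continuous in \<open>t\<close>.
\<close>

lemma lndet_derivative:
  assumes "positive x"
  shows "((\<lambda>t. lndet (x + t *\<^sub>R a)) has_real_derivative ip (jordan_inverse x) a) (at 0)"
proof -
  define h where "h = (\<lambda>t. ip (jordan_inverse (x + t *\<^sub>R a)) a)"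
  have "isCont h 0"
    unfolding h_def by (rule DERIV_isCont[OF inverse_derivative[OF assms]])
  then have "((\<lambda>t. \<bar>h t - h 0\<bar>) \<longlongrightarrow> 0) (at 0)"
    by (simp add: isCont_def LIM_zero_iff tendsto_rabs_zero_iff)
  moreover have "eventually (\<lambda>t. norm ((lndet (x + t *\<^sub>R a) - lndet x) / t - h 0) \<le> \<bar>h t - h 0\<bar>) (at 0)"
  proof -
    have "eventually (\<lambda>t. positive (x + t *\<^sub>R a)) (at 0)"
      using eventually_positive_on_line[OF assms, of a] by (simp add: eventually_at_filter eventually_mono)
    moreover have "eventually (\<lambda>t::real. t \<noteq> 0) (at 0)" by (simp add: eventually_at_filter)
    ultimately show ?thesis
    proof eventually_elim
      case (elim t)
      have up: "lndet (x + t *\<^sub>R a) - lndet x \<le> t * h 0"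
        using lndet_concave[OF assms elim(1)] by (simp add: h_def ip_distribs)
      have lo: "lndet (x + t *\<^sub>R a) - lndet x \<ge> t * h t"
        using lndet_concave[OF elim(1) assms] by (simp add: h_def ip_distribs)
      define q where "q = (lndet (x + t *\<^sub>R a) - lndet x) / t"
      have q: "lndet (x + t *\<^sub>R a) - lndet x = t * q" using elim(2) by (simp add: q_def)
      have "(h t \<le> q \<and> q \<le> h 0) \<or> (h 0 \<le> q \<and> q \<le> h t)"
        using up lo elim(2) unfolding q by (cases "t > 0") auto
      then show ?case unfolding q_def[symmetric] real_norm_def by linarith
    qed
  qed
  ultimately have "((\<lambda>t. (lndet (x + t *\<^sub>R a) - lndet x) / t - h 0) \<longlongrightarrow> 0) (at 0)"
    by (rule Lim_null_comparison[rotated])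
  then show ?thesis
    by (simp add: DERIV_def LIM_zero_iff h_def)
qed

section \<open>The Hessian of the barrier and its inverse\<close>

lemma ip_P_sym: "ip (P x a) b = ip (P x b) a"
  using ip_P[of x a b] ip_sym[of a] by simp

lemma Gamma_barrier_eq:
  assumes "positive w" "v > 0"
  shows "Gamma_barrier J e (u, v, w) =
    - ln (u + v * (lndet w - real (jordan_rank J e) * ln v)) - ln v - lndet w"
  using positive_scale(2)[OF assms(1), of "inverse v"] assms(2)
  by (simp add: Gamma_barrier_def ln_inverse)

text \<open>
  The argument of the logarithm in the barrier, with the scalar factor taken out of the determinant.
\<close>

definition zeta :: "real \<Rightarrow> real \<Rightarrow> 'a \<Rightarrow> real" where
  "zeta u v w = u + v * (lndet w - real (jordan_rank J e) * ln v)"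

definition zeta_deriv :: "real \<Rightarrow> 'a \<Rightarrow> real \<Rightarrow> real \<Rightarrow> 'a \<Rightarrow> real" where
  "zeta_deriv v w p q r = p + q * (lndet w - real (jordan_rank J e) * ln v - jordan_rank J e) + v * ip (jordan_inverse w) r"

definition Gamma_deriv :: "real \<Rightarrow> real \<Rightarrow> 'a \<Rightarrow> real \<Rightarrow> real \<Rightarrow> 'a \<Rightarrow> real" where
  "Gamma_deriv u v w p q r = - (zeta_deriv v w p q r / zeta u v w) - q / v - ip (jordan_inverse w) r"

lemma zeta_derivative:
  assumes "positive w" "v > 0"
  shows "((\<lambda>t. zeta (u + t * p) (v + t * q) (w + t *\<^sub>R r)) has_real_derivative zeta_deriv v w p q r) (at 0)"
proof -
  define L where "L = (\<lambda>t. lndet (w + t *\<^sub>R r))"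
  have L: "(L has_real_derivative ip (jordan_inverse w) r) (at 0)" "L 0 = lndet w"
    unfolding L_def using lndet_derivative[OF assms(1)] by auto
  have "((\<lambda>t. u + t * p + (v + t * q) * (L t - real (jordan_rank J e) * ln (v + t * q)))
      has_real_derivative zeta_deriv v w p q r) (at 0)"
    unfolding zeta_deriv_def using assms(2)
    by (auto intro!: derivative_eq_intros L(1) simp: L(2) field_simps)
  then show ?thesis by (simp add: zeta_def L_def)
qed

lemma zeta_second_derivative:
  assumes "positive w" "v > 0"
  shows "((\<lambda>t. zeta_deriv (v + t * q') (w + t *\<^sub>R r') p q r) has_real_derivative
    q * (ip (jordan_inverse w) r' - real (jordan_rank J e) * q' / v) + q' * ip (jordan_inverse w) r - v * ip (P (jordan_inverse w) r') r) (at 0)"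
proof -
  define L where "L = (\<lambda>t. lndet (w + t *\<^sub>R r'))"
  have L: "(L has_real_derivative ip (jordan_inverse w) r') (at 0)"
    unfolding L_def using lndet_derivative[OF assms(1)] by auto
  have "((\<lambda>t. p + q * (L t - real (jordan_rank J e) * ln (v + t * q') - jordan_rank J e)
      + (v + t * q') * ip (jordan_inverse (w + t *\<^sub>R r')) r) has_real_derivative
      q * (ip (jordan_inverse w) r' - real (jordan_rank J e) * q' / v) + q' * ip (jordan_inverse w) r - v * ip (P (jordan_inverse w) r') r) (at 0)"
    using assms(2)
    by (auto intro!: derivative_eq_intros L inverse_derivative[OF assms(1)] simp: field_simps)
  then show ?thesis by (simp add: zeta_deriv_def L_def)
qed

lemma eventually_in_domain:
  assumes "positive w" "v > 0" "zeta u v w > 0"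
  shows "eventually (\<lambda>t. positive (w + t *\<^sub>R r) \<and> v + t * q > 0 \<and>
    zeta (u + t * p) (v + t * q) (w + t *\<^sub>R r) > 0) (nhds 0)"
proof -
  have pos: "eventually (\<lambda>t. f t > 0) (nhds 0)" if "isCont f 0" "f 0 > 0" for f :: "real \<Rightarrow> real"
    using that order_tendstoD(1)[of f "f 0" "nhds 0" 0]
    by (simp add: isCont_def tendsto_at_iff_tendsto_nhds)
  have "eventually (\<lambda>t. zeta (u + t * p) (v + t * q) (w + t *\<^sub>R r) > 0) (nhds 0)"
    by (rule pos[OF DERIV_isCont[OF zeta_derivative[OF assms(1,2)]]]) (use assms(3) in simp)
  moreover have "eventually (\<lambda>t. v + t * q > 0) (nhds 0)"
    by (rule pos) (use assms(2) in \<open>auto intro!: continuous_intros\<close>)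
  ultimately show ?thesis
    using eventually_positive_on_line[OF assms(1), of r] by eventually_elim simp
qed

lemma Gamma_derivative:
  assumes "positive w" "v > 0" "zeta u v w > 0"
  shows "((\<lambda>t. Gamma_barrier J e ((u, v, w) + t *\<^sub>R (p, q, r))) has_real_derivative Gamma_deriv u v w p q r) (at 0)"
proof -
  let ?g = "\<lambda>t. - ln (zeta (u + t * p) (v + t * q) (w + t *\<^sub>R r)) - ln (v + t * q) - lndet (w + t *\<^sub>R r)"
  have "eventually (\<lambda>t. Gamma_barrier J e ((u, v, w) + t *\<^sub>R (p, q, r)) = ?g t) (nhds 0)"
    using eventually_in_domain[OF assms, of r q p]
    by eventually_elim (simp add: Gamma_barrier_eq zeta_def)
  moreover have "(?g has_real_derivative Gamma_deriv u v w p q r) (at 0)"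
  proof -
    define L where "L = (\<lambda>t. lndet (w + t *\<^sub>R r))"
    have L: "(L has_real_derivative ip (jordan_inverse w) r) (at 0)"
      unfolding L_def using lndet_derivative[OF assms(1)] by auto
    have "((\<lambda>t. - ln (zeta (u + t * p) (v + t * q) (w + t *\<^sub>R r)) - ln (v + t * q) - L t)
        has_real_derivative Gamma_deriv u v w p q r) (at 0)"
      unfolding Gamma_deriv_def using assms(2,3)
      by (auto intro!: derivative_eq_intros zeta_derivative[OF assms(1,2)] L simp: field_simps)
    then show ?thesis by (simp add: L_def)
  qed
  ultimately show ?thesis by (subst DERIV_cong_ev[OF refl _ refl])
qed

text \<open>
  The numerator of the subtracted quotient is the second derivative of \<open>zeta\<close>.
\<close>

definition Gamma_second_deriv ::
  "real \<Rightarrow> real \<Rightarrow> 'a \<Rightarrow> real \<Rightarrow> real \<Rightarrow> 'a \<Rightarrow> real \<Rightarrow> real \<Rightarrow> 'a \<Rightarrow> real" where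
  "Gamma_second_deriv u v w p q r p' q' r' =
     zeta_deriv v w p q r * zeta_deriv v w p' q' r' / (zeta u v w)\<^sup>2
     - (q * (ip (jordan_inverse w) r' - real (jordan_rank J e) * q' / v) + q' * ip (jordan_inverse w) r - v * ip (P (jordan_inverse w) r') r) / zeta u v w
     + q * q' / v\<^sup>2 + ip (P (jordan_inverse w) r') r"

lemma Gamma_second_derivative:
  assumes "positive w" "v > 0" "zeta u v w > 0"
  shows "((\<lambda>t. Gamma_deriv (u + t * p') (v + t * q') (w + t *\<^sub>R r') p q r) has_real_derivative
    Gamma_second_deriv u v w p q r p' q' r') (at 0)"
  unfolding Gamma_deriv_def
  using assms(2,3)
  by (auto intro!: derivative_eq_intros zeta_derivative[OF assms(1,2)] zeta_second_derivative[OF assms(1,2)]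
      inverse_derivative[OF assms(1)] simp: Gamma_second_deriv_def)
     (simp add: field_simps power2_eq_square)

lemma second_directional_deriv_Gamma:
  assumes "positive w" "v > 0" "zeta u v w > 0"
  shows "second_directional_deriv (Gamma_barrier J e) (u, v, w) (p, q, r) (p', q', r') =
    Gamma_second_deriv u v w p q r p' q' r'"
proof -
  have "eventually (\<lambda>s::real. deriv (\<lambda>t. Gamma_barrier J e ((u, v, w) + s *\<^sub>R (p', q', r') + t *\<^sub>R (p, q, r))) 0
      = Gamma_deriv (u + s * p') (v + s * q') (w + s *\<^sub>R r') p q r) (nhds 0)"
    using eventually_in_domain[OF assms, of r' q' p']
  proof eventually_elim
    case (elim s)
    then show ?case
      using Gamma_derivative[of "w + s *\<^sub>R r'" "v + s * q'" "u + s * p'" p q r]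
      by (intro DERIV_imp_deriv) simp
  qed
  then have "((\<lambda>s. deriv (\<lambda>t. Gamma_barrier J e ((u, v, w) + s *\<^sub>R (p', q', r') + t *\<^sub>R (p, q, r))) 0)
      has_real_derivative Gamma_second_deriv u v w p q r p' q' r') (at 0)"
    using Gamma_second_derivative[OF assms] by (subst DERIV_cong_ev[OF refl _ refl])
  then show ?thesis
    unfolding second_directional_deriv_def by (rule DERIV_imp_deriv)
qed

text \<open>
  This makes the operator that represents the second derivative unique.
\<close>

lemma product_inner_nondegenerate:
  assumes "\<And>b. product_inner J e x b = product_inner J e y b"
  shows "x = y"
proof -
  obtain p q r p' q' r' where xy: "x = (p, q, r)" "y = (p', q', r')" by (metis surj_pair)
  have "p = p'" using assms[of "(1, 0, 0)"] by (simp add: xy product_inner_def)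
  moreover have "q = q'" using assms[of "(0, 1, 0)"] by (simp add: xy product_inner_def)
  moreover have "ip (r - r') (r - r') = 0"
    using assms[of "(0, 0, r - r')"] by (simp add: xy product_inner_def ip_distribs(3))
  ultimately show ?thesis by (simp add: xy ip_eq_0_iff)
qed

text \<open>
  Obtained from \<open>Gamma_second_deriv\<close> by collecting the coefficients of the second direction.
\<close>

definition Gamma_hessian :: "real \<Rightarrow> real \<Rightarrow> 'a \<Rightarrow> real \<times> real \<times> 'a \<Rightarrow> real \<times> real \<times> 'a" where
  "Gamma_hessian u v w = (\<lambda>(p, q, r).
    let d = jordan_rank J e; z = zeta u v w; s = zeta_deriv v w p q r / z\<^sup>2 in
    (s,
     s * (lndet w - d * ln v - d) - (ip (jordan_inverse w) r - d * q / v) / z + q / v\<^sup>2,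
     (v * s - q / z) *\<^sub>R jordan_inverse w + (v / z + 1) *\<^sub>R P (jordan_inverse w) r))"

lemma product_inner_Gamma_hessian:
  assumes "v > 0" "zeta u v w > 0"
  shows "product_inner J e (Gamma_hessian u v w (p, q, r)) (p', q', r') = Gamma_second_deriv u v w p q r p' q' r'"
proof -
  have "ip (P (jordan_inverse w) r) r' = ip (P (jordan_inverse w) r') r"
    by (rule ip_P_sym)
  then show ?thesis
    using assms unfolding Gamma_hessian_def product_inner_def Gamma_second_deriv_def zeta_deriv_def[of v w p' q' r'] Let_def
    by (simp add: ip_distribs) (simp add: field_simps power2_eq_square)
qed

lemma linear_Gamma_hessian: "linear (Gamma_hessian u v w)"
proof (rule linearI)
  show "Gamma_hessian u v w (a + b) = Gamma_hessian u v w a + Gamma_hessian u v w b" for a b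
    by (cases a; cases b)
       (simp add: Gamma_hessian_def zeta_deriv_def Let_def ip_distribs P_distribs add_divide_distrib diff_divide_distrib algebra_simps)
  show "Gamma_hessian u v w (k *\<^sub>R a) = k *\<^sub>R Gamma_hessian u v w a" for k a
    by (cases a)
       (simp add: Gamma_hessian_def zeta_deriv_def Let_def ip_distribs P_distribs algebra_simps)
qed

lemma hessian_operator_Gamma:
  assumes "positive w" "v > 0" "zeta u v w > 0"
  shows "hessian_operator (product_inner J e) (Gamma_barrier J e) (u, v, w) = Gamma_hessian u v w"
  unfolding hessian_operator_def
proof (rule the_equality)
  have *: "product_inner J e (Gamma_hessian u v w a) b = second_directional_deriv (Gamma_barrier J e) (u, v, w) a b" for a b
    by (cases a; cases b) (simp add: product_inner_Gamma_hessian[OF assms(2,3)] second_directional_deriv_Gamma[OF assms])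
  then show "linear (Gamma_hessian u v w) \<and> (\<forall>a b. product_inner J e (Gamma_hessian u v w a) b =
      second_directional_deriv (Gamma_barrier J e) (u, v, w) a b)"
    using linear_Gamma_hessian by blast
  fix A assume "linear A \<and> (\<forall>a b. product_inner J e (A a) b =
      second_directional_deriv (Gamma_barrier J e) (u, v, w) a b)"
  then show "A = Gamma_hessian u v w"
    using * product_inner_nondegenerate by (metis ext)
qed

lemma Gamma_second_deriv_sym: "Gamma_second_deriv u v w p q r p' q' r' = Gamma_second_deriv u v w p' q' r' p q r"
  unfolding Gamma_second_deriv_def ip_P_sym[of "jordan_inverse w" r r'] by (simp add: algebra_simps)

text \<open>
  The kernel of a symmetric operator is orthogonal to its range.
\<close>

lemma inj_if_surj_Gamma_hessian:
  assumes "v > 0" "zeta u v w > 0" "surj (Gamma_hessian u v w)"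
  shows "inj (Gamma_hessian u v w)"
proof -
  have sym: "product_inner J e (Gamma_hessian u v w a) b = product_inner J e a (Gamma_hessian u v w b)" for a b
  proof -
    have "product_inner J e (Gamma_hessian u v w a) b = product_inner J e (Gamma_hessian u v w b) a"
      using Gamma_second_deriv_sym by (cases a; cases b) (simp only: product_inner_Gamma_hessian[OF assms(1,2)])
    also have "\<dots> = product_inner J e a (Gamma_hessian u v w b)"
      by (cases a; cases "Gamma_hessian u v w b") (simp add: product_inner_def ip_sym mult.commute)
    finally show ?thesis .
  qed
  have "x = y" if "Gamma_hessian u v w x = Gamma_hessian u v w y" for x y
  proof (rule product_inner_nondegenerate)
    fix b
    obtain c where "b = Gamma_hessian u v w c" using assms(3) by (metis surjD)
    then show "product_inner J e x b = product_inner J e y b"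
      using sym[of x c] sym[of y c] that by simp
  qed
  then show ?thesis by (simp add: inj_def)
qed

text \<open>
  Since \<open>P (w\<^sup>1\<^sup>/\<^sup>2)\<close> squares to \<open>P w\<close>, which inverts \<open>P (w\<^sup>-\<^sup>1)\<close>, the last component of the equation can
  be solved for \<open>Hw\<close> in terms of \<open>Hv\<close>. The trace of the result turns the second component into a scalar
  equation for \<open>Hv\<close> with coefficient \<open>1 / \<theta>\<close> up to the factor \<open>\<zeta> + v\<close>, and the first component
  yields \<open>Hu\<close>.
\<close>

lemma Gamma_hessian_solution:
  fixes u v p q :: real and w r :: 'a
  assumes "positive w" "v > 0" "zeta u v w > 0"
  defines "d \<equiv> jordan_rank J e" and "\<phi> \<equiv> - (lndet w - real (jordan_rank J e) * ln v)" and "\<zeta> \<equiv> zeta u v w"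
    and "r' \<equiv> P (jordan_sqrt J e w) r"
  assumes \<theta>: "\<theta> = v\<^sup>2 * inverse (\<zeta> + (1 + real d) * v)"
    and Hv: "Hv = \<theta> * ((\<zeta> + v) * (\<phi> * p + q) + real d * \<zeta> * p + tr r')"
    and Hu: "Hu = \<zeta> * inverse (\<zeta> + v) * (real d * v\<^sup>2 * p + real d * Hv - v * ip w r)
              + \<zeta>\<^sup>2 * p + \<phi> * Hv"
    and Hw: "Hw = inverse (\<zeta> + v) *\<^sub>R
              P (jordan_sqrt J e w) ((- \<zeta> * p * v + Hv) *\<^sub>R e + \<zeta> *\<^sub>R r')"
  shows "Gamma_hessian u v w (Hu, Hv, Hw) = (p, q, r)"
proof -
  have pos: "v > 0" "\<zeta> > 0" "\<zeta> + v > 0" "\<zeta> + (1 + real d) * v > 0"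
    using assms(2,3) by (auto simp: \<zeta>_def intro: add_pos_nonneg)
  define T where "T = ip w r"
  define k where "k = - \<zeta> * p * v + Hv"
  have T: "tr r' = T"
    by (simp add: r'_def tr_P sqrt_mult_sqrt[OF assms(1)] T_def)
  have "P (jordan_sqrt J e w) e = w"
    using sqrt_mult_sqrt[OF assms(1)] by (simp add: quad_rep_def scaleR_2)
  then have Hw': "Hw = inverse (\<zeta> + v) *\<^sub>R (k *\<^sub>R w + \<zeta> *\<^sub>R P w r)"
    by (simp add: Hw k_def P_distribs r'_def P_sqrt_P_sqrt[OF assms(1)])
  have Pw: "P (jordan_inverse w) w = jordan_inverse w" using P_inverse_P[OF assms(1), of "jordan_inverse w"] P_inverse[OF assms(1)] by simp
  have PHw: "P (jordan_inverse w) Hw = inverse (\<zeta> + v) *\<^sub>R (k *\<^sub>R jordan_inverse w + \<zeta> *\<^sub>R r)"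
    by (simp add: Hw' P_distribs Pw P_inverse_P[OF assms(1)])
  have "ip (jordan_inverse w) w = d"
    using inverse_mult[OF assms(1)] by (simp add: jordan_inner_def commute d_def rank_eq_tr)
  moreover have "ip (jordan_inverse w) (P w r) = T"
    by (simp add: T_def P_inverse[OF assms(1)] flip: ip_P)
  ultimately have W: "ip (jordan_inverse w) Hw = (k * d + \<zeta> * T) / (\<zeta> + v)"
    by (simp add: Hw' ip_distribs divide_inverse mult.commute)
  have "Hu - (\<phi> + d) * Hv + v * ((k * d + \<zeta> * T) / (\<zeta> + v)) = \<zeta>\<^sup>2 * p"
  proof -
    have "Hu = \<zeta> * (d * v\<^sup>2 * p + d * Hv - v * T) / (\<zeta> + v) + \<zeta>\<^sup>2 * p + \<phi> * Hv"
      by (simp add: Hu T_def divide_inverse)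
    then show ?thesis
      using pos by (simp add: k_def divide_simps) (simp add: algebra_simps power2_eq_square)
  qed
  then have "zeta_deriv v w Hu Hv Hw = \<zeta>\<^sup>2 * p"
    by (simp add: zeta_deriv_def W \<phi>_def d_def algebra_simps)
  then have s: "zeta_deriv v w Hu Hv Hw / \<zeta>\<^sup>2 = p" using pos by simp
  have HvN: "Hv * (\<zeta> + (1 + real d) * v) = v\<^sup>2 * ((\<zeta> + v) * (\<phi> * p + q) + d * \<zeta> * p + T)"
    using pos by (simp add: Hv \<theta> T field_simps)
  define S where "S = (k * d + \<zeta> * T) / (\<zeta> + v)"
  have S: "S * (\<zeta> + v) = k * d + \<zeta> * T" using pos by (simp add: S_def)
  define E where "E = p * (- \<phi> - d) - (S - d * Hv / v) / \<zeta> + Hv / v\<^sup>2"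
  have E: "E * (v\<^sup>2 * \<zeta>) = p * (- \<phi> - d) * v\<^sup>2 * \<zeta> - S * v\<^sup>2 + (d * Hv * v + Hv * \<zeta>)"
    using pos by (simp add: E_def field_simps power2_eq_square)
  have "E * (v\<^sup>2 * \<zeta>) * (\<zeta> + v) =
      p * (- \<phi> - d) * v\<^sup>2 * \<zeta> * (\<zeta> + v) - (S * (\<zeta> + v)) * v\<^sup>2 + (d * Hv * v + Hv * \<zeta>) * (\<zeta> + v)"
    unfolding E by (simp only: algebra_simps)
  also have "\<dots> = p * (- \<phi> - d) * v\<^sup>2 * \<zeta> * (\<zeta> + v) - (\<zeta> * T - \<zeta> * p * v * d) * v\<^sup>2
      + \<zeta> * (Hv * (\<zeta> + (1 + real d) * v))"
    unfolding S k_def by (simp add: algebra_simps power2_eq_square)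
  also have "\<dots> = q * (v\<^sup>2 * \<zeta>) * (\<zeta> + v)"
    unfolding HvN by (simp add: algebra_simps power2_eq_square)
  finally have "E = q" using pos by simp
  then have "p * (- \<phi> - d) - ((k * d + \<zeta> * T) / (\<zeta> + v) - d * Hv / v) / \<zeta> + Hv / v\<^sup>2 = q"
    by (simp only: E_def S_def)
  moreover have "(v * p - Hv / \<zeta>) *\<^sub>R jordan_inverse w + (v / \<zeta> + 1) *\<^sub>R P (jordan_inverse w) Hw = r"
  proof -
    have "(v / \<zeta> + 1) * inverse (\<zeta> + v) = inverse \<zeta>" using pos by (simp add: field_simps)
    then have "(v / \<zeta> + 1) *\<^sub>R P (jordan_inverse w) Hw = inverse \<zeta> *\<^sub>R (k *\<^sub>R jordan_inverse w + \<zeta> *\<^sub>R r)"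
      by (simp add: PHw)
    also have "\<dots> = (inverse \<zeta> * k) *\<^sub>R jordan_inverse w + r" using pos by (simp add: scaleR_add_right)
    also have "inverse \<zeta> * k = - (v * p - Hv / \<zeta>)" using pos by (simp add: k_def field_simps)
    finally show ?thesis by (simp only: scaleR_minus_left add_minus_cancel)
  qed
  moreover have "Gamma_hessian u v w (Hu, Hv, Hw) = (p, p * (lndet w - d * ln v - d)
      - (ip (jordan_inverse w) Hw - d * Hv / v) / \<zeta> + Hv / v\<^sup>2,
      (v * p - Hv / \<zeta>) *\<^sub>R jordan_inverse w + (v / \<zeta> + 1) *\<^sub>R P (jordan_inverse w) Hw)"
    using s by (simp only: Gamma_hessian_def Let_def prod.case \<zeta>_def d_def)
  moreover have "lndet w - d * ln v - d = - \<phi> - d" by (simp only: \<phi>_def d_def minus_minus)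
  ultimately show ?thesis by (simp only: W)
qed

lemma bij_Gamma_hessian:
  assumes "positive w" "v > 0" "zeta u v w > 0"
  shows "bij (Gamma_hessian u v w)"
proof -
  have "\<exists>x. Gamma_hessian u v w x = y" for y
    using Gamma_hessian_solution[OF assms refl refl refl refl] by (cases y) blast
  then have "surj (Gamma_hessian u v w)" by (metis surj_def)
  then show ?thesis using inj_if_surj_Gamma_hessian[OF assms(2,3)] by (simp add: bij_def)
qed

end

theorem mainTheorem5:
  fixes J :: "'a::real_normed_vector \<Rightarrow> 'a \<Rightarrow> 'a" and e :: 'a and d :: nat
    and u v p q :: real and w r :: 'a
    and \<phi> \<zeta> \<theta> Hu Hv :: real and r' Hw :: 'a
    and H :: "real \<times> real \<times> 'a \<Rightarrow> real \<times> real \<times> 'a"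
  assumes "euclidean_jordan_algebra J e"
    and "d = jordan_rank J e"
    and "(u, v, w) \<in> Gamma_dom J e"
    and "\<phi> = - ln (jordan_det J e (inverse v *\<^sub>R w))"
    and "\<zeta> = u - v * \<phi>"
    and "r' = quad_rep J (jordan_sqrt J e w) r"
    and "\<theta> = v\<^sup>2 * inverse (\<zeta> + (1 + real d) * v)"
    and "Hv = \<theta> * ((\<zeta> + v) * (\<phi> * p + q) + real d * \<zeta> * p + jordan_tr J e r')"
    and "Hu = \<zeta> * inverse (\<zeta> + v) * (real d * v\<^sup>2 * p + real d * Hv - v * jordan_inner J e w r)
              + \<zeta>\<^sup>2 * p + \<phi> * Hv"
    and "Hw = inverse (\<zeta> + v) *\<^sub>R
              quad_rep J (jordan_sqrt J e w) ((- \<zeta> * p * v + Hv) *\<^sub>R e + \<zeta> *\<^sub>R r')"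
    and "H = hessian_operator (product_inner J e) (Gamma_barrier J e) (u, v, w)"
  shows "bij H \<and> inv H (p, q, r) = (Hu, Hv, Hw)"
proof -
  interpret euclidean_jordan_algebra J e by fact
  have dom: "v > 0" "positive w" "u + v * ln (jordan_det J e (inverse v *\<^sub>R w)) > 0"
    using assms(3) interior_cone_positive by (auto simp: Gamma_dom_def)
  have ln: "ln (jordan_det J e (inverse v *\<^sub>R w)) = lndet w - real (jordan_rank J e) * ln v"
    using positive_scale(2)[OF dom(2), of "inverse v"] dom(1) by (simp add: ln_inverse)
  have z: "zeta u v w > 0" using dom(3) by (simp only: zeta_def ln)
  have \<phi>: "\<phi> = - (lndet w - real (jordan_rank J e) * ln v)"
    using assms(4) by (simp only: ln)
  have \<zeta>: "\<zeta> = zeta u v w"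
    unfolding assms(5) \<phi> zeta_def by (simp only: mult_minus_right diff_minus_eq_add)
  have H: "H = Gamma_hessian u v w"
    unfolding assms(11) by (rule hessian_operator_Gamma[OF dom(2,1) z])
  have sol: "H (Hu, Hv, Hw) = (p, q, r)"
    unfolding H by (rule Gamma_hessian_solution[OF dom(2,1) z assms(7-10)[unfolded assms(2,6) \<phi> \<zeta>]])
  have "bij H" unfolding H by (rule bij_Gamma_hessian[OF dom(2,1) z])
  then show ?thesis using sol by (simp add: bij_is_inj inv_f_eq)
qed

end
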